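(* Let $\mathfrak g$ be a semisimple complex Lie algebra, let $\theta\in\operatorname{Aut}\mathfrak g$ be an element of order $2$, and put $\mathfrak k=\{y\in\mathfrak g\mid\theta(y)=y\}$, $\mathfrak p=\{y\in\mathfrak g\mid\theta(y)=-y\}$. Let $K$ be the connected subgroup of the adjoint group of $\mathfrak g$ with Lie algebra $\mathfrak k$. Let $\mathcal O$ be a $K$-orbit in $\mathcal N(\mathfrak p)$ and let $x\in\mathcal O$. The following are equivalent: (i) $\mathcal O$ is $(-1)$-distinguished; (ii) the reductive Levi factors of $\mathfrak z_{\mathfrak k}(x)$ and $\mathfrak z_{\mathfrak g}(x)$ have the same dimension; (iii) the reductive Levi factors of $\mathfrak z_{\mathfrak k}(x)$ and $\mathfrak z_{\mathfrak g}(x)$ are isomorphic.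
   Context: $\mathcal N(\mathfrak p)$ denotes the set of nilpotent elements of $\mathfrak g$ that lie in $\mathfrak p$. For $x\in\mathfrak p$, $\mathfrak z_{\mathfrak g}(x)$ is the centralizer of $x$ in $\mathfrak g$, $\mathfrak z_{\mathfrak k}(x)=\mathfrak z_{\mathfrak g}(x)\cap\mathfrak k$ and $\mathfrak z_{\mathfrak p}(x)=\mathfrak z_{\mathfrak g}(x)\cap\mathfrak p$. An element $x\in\mathcal N(\mathfrak p)$, and its $K$-orbit, are called $(-1)$-distinguished if $\mathfrak z_{\mathfrak p}(x)$ contains no nonzero semisimple elements. For an algebraic Lie algebra $\mathfrak c$, its reductive Levi factor is $\mathfrak c/\operatorname{rad}_u\mathfrak c$, where $\operatorname{rad}_u\mathfrak c$ (the unipotent radical) is the maximal ideal of $\mathfrak c$ consisting of nilpotent elements. *)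

theory Defs
  imports "HOL-Analysis.Analysis"
begin

text \<open>A finite-dimensional complex Lie algebra is modelled as the complex vector space
  complex^'n together with a bracket B.  Linear maps/subspaces/dimension are taken
  over the field of complex numbers via the vec interpretation of vector_space (*s).\<close>

type_synonym 'n cvec = "complex ^ 'n"

definition clinear :: "(('n::finite) cvec \<Rightarrow> 'n cvec) \<Rightarrow> bool" where
  "clinear f \<longleftrightarrow> Vector_Spaces.linear ((*s)) ((*s)) f"

definition lie_algebra :: "(('n::finite) cvec \<Rightarrow> 'n cvec \<Rightarrow> 'n cvec) \<Rightarrow> bool" where
  "lie_algebra B \<longleftrightarrow>
     (\<forall>x. clinear (B x)) \<and> (\<forall>y. clinear (\<lambda>x. B x y)) \<and>
     (\<forall>x. B x x = 0) \<and>
     (\<forall>x y z. B x (B y z) + B y (B z x) + B z (B x y) = 0)"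

definition lie_subalgebra :: "(('n::finite) cvec \<Rightarrow> 'n cvec \<Rightarrow> 'n cvec) \<Rightarrow> 'n cvec set \<Rightarrow> bool" where
  "lie_subalgebra B c \<longleftrightarrow> vec.subspace c \<and> (\<forall>u\<in>c. \<forall>v\<in>c. B u v \<in> c)"

text \<open>I is an ideal of the subalgebra c.\<close>
definition lie_ideal_in :: "(('n::finite) cvec \<Rightarrow> 'n cvec \<Rightarrow> 'n cvec) \<Rightarrow> 'n cvec set \<Rightarrow> 'n cvec set \<Rightarrow> bool" where
  "lie_ideal_in B I c \<longleftrightarrow> vec.subspace I \<and> I \<subseteq> c \<and> (\<forall>u\<in>c. \<forall>v\<in>I. B u v \<in> I)"

definition derived :: "(('n::finite) cvec \<Rightarrow> 'n cvec \<Rightarrow> 'n cvec) \<Rightarrow> 'n cvec set \<Rightarrow> 'n cvec set" where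
  "derived B I = vec.span {B u v | u v. u \<in> I \<and> v \<in> I}"

definition solvable_set :: "(('n::finite) cvec \<Rightarrow> 'n cvec \<Rightarrow> 'n cvec) \<Rightarrow> 'n cvec set \<Rightarrow> bool" where
  "solvable_set B I \<longleftrightarrow> (\<exists>k. (derived B ^^ k) I = {0})"

text \<open>Semisimple: no nonzero solvable ideals (radical is zero).\<close>
definition semisimple_lie :: "(('n::finite) cvec \<Rightarrow> 'n cvec \<Rightarrow> 'n cvec) \<Rightarrow> bool" where
  "semisimple_lie B \<longleftrightarrow> lie_algebra B \<and>
     (\<forall>I. lie_ideal_in B I UNIV \<and> solvable_set B I \<longrightarrow> I = {0})"

definition lie_automorphism :: "(('n::finite) cvec \<Rightarrow> 'n cvec \<Rightarrow> 'n cvec) \<Rightarrow> ('n cvec \<Rightarrow> 'n cvec) \<Rightarrow> bool" where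
  "lie_automorphism B \<theta> \<longleftrightarrow> clinear \<theta> \<and> bij \<theta> \<and> (\<forall>x y. \<theta> (B x y) = B (\<theta> x) (\<theta> y))"

text \<open>Nilpotent element of g: ad x is a nilpotent endomorphism.\<close>
definition nilpotent_elt :: "(('n::finite) cvec \<Rightarrow> 'n cvec \<Rightarrow> 'n cvec) \<Rightarrow> 'n cvec \<Rightarrow> bool" where
  "nilpotent_elt B x \<longleftrightarrow> (\<exists>k. \<forall>y. (B x ^^ k) y = 0)"

text \<open>Semisimple element of g: ad x is diagonalizable (eigenvectors span g).\<close>
definition semisimple_elt :: "(('n::finite) cvec \<Rightarrow> 'n cvec \<Rightarrow> 'n cvec) \<Rightarrow> 'n cvec \<Rightarrow> bool" where
  "semisimple_elt B x \<longleftrightarrow> vec.span {v. \<exists>c::complex. B x v = c *s v} = UNIV"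

definition fixed_space :: "(('n::finite) cvec \<Rightarrow> 'n cvec) \<Rightarrow> 'n cvec set" where
  "fixed_space \<theta> = {y. \<theta> y = y}"

definition anti_space :: "(('n::finite) cvec \<Rightarrow> 'n cvec) \<Rightarrow> 'n cvec set" where
  "anti_space \<theta> = {y. \<theta> y = - y}"

definition centralizer :: "(('n::finite) cvec \<Rightarrow> 'n cvec \<Rightarrow> 'n cvec) \<Rightarrow> 'n cvec \<Rightarrow> 'n cvec set" where
  "centralizer B x = {y. B x y = 0}"

text \<open>Unipotent radical of c: the maximal ideal of c consisting of nilpotent elements.\<close>
definition rad_u :: "(('n::finite) cvec \<Rightarrow> 'n cvec \<Rightarrow> 'n cvec) \<Rightarrow> 'n cvec set \<Rightarrow> 'n cvec set" where
  "rad_u B c = (THE I. lie_ideal_in B I c \<and> (\<forall>u\<in>I. nilpotent_elt B u) \<and>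
       (\<forall>J. lie_ideal_in B J c \<and> (\<forall>u\<in>J. nilpotent_elt B u) \<longrightarrow> J \<subseteq> I))"

text \<open>Dimension of the reductive Levi factor c / rad_u c.\<close>
definition levi_dim :: "(('n::finite) cvec \<Rightarrow> 'n cvec \<Rightarrow> 'n cvec) \<Rightarrow> 'n cvec set \<Rightarrow> nat" where
  "levi_dim B c = vec.dim c - vec.dim (rad_u B c)"

text \<open>The quotient Lie algebras c/I and d/J are isomorphic: there is a linear map f,
  sending c into d, inducing a surjective Lie homomorphism c \<rightarrow> d/J with kernel I.\<close>
definition quotients_iso ::
  "(('n::finite) cvec \<Rightarrow> 'n cvec \<Rightarrow> 'n cvec) \<Rightarrow> 'n cvec set \<Rightarrow> 'n cvec set \<Rightarrow> 'n cvec set \<Rightarrow> 'n cvec set \<Rightarrow> bool" where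
  "quotients_iso B c I d J \<longleftrightarrow> (\<exists>f. clinear f \<and> f ` c \<subseteq> d \<and>
      (\<forall>w\<in>d. \<exists>u\<in>c. w - f u \<in> J) \<and>
      (\<forall>u\<in>c. f u \<in> J \<longleftrightarrow> u \<in> I) \<and>
      (\<forall>u\<in>c. \<forall>v\<in>c. f (B u v) - B (f u) (f v) \<in> J))"

definition levi_iso :: "(('n::finite) cvec \<Rightarrow> 'n cvec \<Rightarrow> 'n cvec) \<Rightarrow> 'n cvec set \<Rightarrow> 'n cvec set \<Rightarrow> bool" where
  "levi_iso B c d \<longleftrightarrow> quotients_iso B c (rad_u B c) d (rad_u B d)"

text \<open>x in N(p) is (-1)-distinguished: z_p(x) contains no nonzero semisimple elements.\<close>
definition minus1_distinguished :: "(('n::finite) cvec \<Rightarrow> 'n cvec \<Rightarrow> 'n cvec) \<Rightarrow> ('n cvec \<Rightarrow> 'n cvec) \<Rightarrow> 'n cvec \<Rightarrow> bool" where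
  "minus1_distinguished B \<theta> x \<longleftrightarrow>
     (\<forall>y \<in> centralizer B x \<inter> anti_space \<theta>. semisimple_elt B y \<longrightarrow> y = 0)"

end

theory Submission
  imports Defs "HOL-Computational_Algebra.Fundamental_Theorem_Algebra"
begin

text \<open>
  Write c for the centralizer of x and N for the radical of the Killing form \<kappa> restricted to c.
  For an element y let S(y) be the linear map acting as the complex conjugate of l on the generalized
  l-eigenspace of ad y. It is a derivation, and the trace of S(y) ad y is the sum of |l|^2 over the
  eigenvalues l of ad y, so y is nilpotent as soon as this trace vanishes. Applied to the derived
  algebra of the radical of \<kappa>, this gives Cartan's criterion (via Engel's theorem), hence S(y) = ad s for
  some semisimple s, which commutes with x if y does and which lies in \<pp> if y does.

  Consequently N consists of nilpotent elements (for u in N, s lies in c and \<kappa>(u, s) = 0), and by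
  Engel every ideal of nilpotent elements is orthogonal to c, so N is the unipotent radical of c. Since
  \<kk> and \<pp> are orthogonal, the unipotent radical of the \<kk>-part of c is the \<kk>-part of N. All three
  conditions therefore say that the \<pp>-part of c lies in N. For condition (i): if the \<pp>-part has no
  nonzero semisimple elements, then s = 0, so it consists of nilpotent elements, and polarizing
  \<kappa>(y, y) = 0 shows that it is orthogonal to c.
\<close>

section \<open>Linear maps and traces\<close>

lemma clinear_iff:
  "clinear f \<longleftrightarrow> (\<forall>x y. f (x + y) = f x + f y) \<and> (\<forall>c x. f (c *s x) = c *s f x)"
  unfolding clinear_def Vector_Spaces.linear_iff by (simp add: vec.vector_space_axioms)

lemma clinear_add: "clinear f \<Longrightarrow> f (x + y) = f x + f y"
  and clinear_scale: "clinear f \<Longrightarrow> f (c *s x) = c *s f x"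
  by (auto simp: clinear_iff)

lemma clinear_0: "clinear f \<Longrightarrow> f 0 = 0"
  and clinear_diff: "clinear f \<Longrightarrow> f (x - y) = f x - f y"
  and clinear_minus: "clinear f \<Longrightarrow> f (- x) = - f x"
  and clinear_sum: "clinear f \<Longrightarrow> f (sum h A) = (\<Sum>a\<in>A. f (h a))"
  unfolding clinear_def
  by (simp_all add: vec.linear_0 vec.linear_diff vec.linear_neg vec.linear_sum)

lemma clinear_comp: "clinear f \<Longrightarrow> clinear g \<Longrightarrow> clinear (f \<circ> g)"
  and clinear_compose: "clinear f \<Longrightarrow> clinear g \<Longrightarrow> clinear (\<lambda>v. f (g v))"
  and clinear_sub: "clinear f \<Longrightarrow> clinear g \<Longrightarrow> clinear (\<lambda>v. f v - g v)"
  and clinear_plus: "clinear f \<Longrightarrow> clinear g \<Longrightarrow> clinear (\<lambda>v. f v + g v)"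
  and clinear_scaled: "clinear f \<Longrightarrow> clinear (\<lambda>v. c *s f v)"
  and clinear_uminus: "clinear f \<Longrightarrow> clinear (\<lambda>v. - f v)"
  and clinear_id: "clinear id"
  and clinear_ident: "clinear (\<lambda>v. v)"
  by (simp_all add: clinear_iff algebra_simps)

lemmas clinear_intros = clinear_comp clinear_sub clinear_plus clinear_scaled
  clinear_uminus clinear_id clinear_ident

lemma clinear_funpow: "clinear f \<Longrightarrow> clinear (f ^^ k)"
  by (induction k) (auto simp: clinear_intros)

lemma clinear_eq_on_span:
  assumes "clinear f" "clinear g" "\<And>v. v \<in> A \<Longrightarrow> f v = g v" "v \<in> vec.span A"
  shows "f v = g v"
  using assms vec.linear_eq_on_span unfolding clinear_def by blast

lemma subspace_vimage: "clinear f \<Longrightarrow> vec.subspace W \<Longrightarrow> vec.subspace {v. f v \<in> W}"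
  by (auto simp: vec.subspace_def clinear_0 clinear_add clinear_scale)

lemma subspace_kernel: "clinear f \<Longrightarrow> vec.subspace {v. f v = 0}"
  using subspace_vimage[of f "{0}"] by simp

text \<open>A left inverse of the identity on \<open>W\<close>, with values in \<open>W\<close>, is
  such a projection.\<close>

lemma projection_exists:
  fixes W :: "(complex ^ 'n) set"
  assumes "vec.subspace W"
  shows "\<exists>\<pi>. clinear \<pi> \<and> (\<forall>v. \<pi> v \<in> W) \<and> (\<forall>v\<in>W. \<pi> v = v)"
  using vec.linear_exists_left_inverse_on[OF vec.linear_id assms] unfolding clinear_def by auto

definition tr :: "(complex ^ 'n \<Rightarrow> complex ^ 'n) \<Rightarrow> complex" where
  "tr f = (\<Sum>i\<in>UNIV. f (axis i 1) $ i)"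

lemma tr_add: "tr (\<lambda>v. f v + g v) = tr f + tr g"
  and tr_diff: "tr (\<lambda>v. f v - g v) = tr f - tr g"
  and tr_scale: "tr (\<lambda>v. c *s f v) = c * tr f"
  and tr_zero: "tr (\<lambda>v. 0) = 0"
  by (simp_all add: tr_def sum.distrib sum_subtractf sum_distrib_left)

lemma clinear_expand:
  fixes f :: "complex ^ 'n \<Rightarrow> complex ^ 'n"
  assumes "clinear f"
  shows "f v = (\<Sum>j\<in>UNIV. v $ j *s f (axis j 1))"
proof -
  have "f v = f (\<Sum>j\<in>UNIV. v $ j *s axis j 1)"
    by (simp add: basis_expansion)
  then show ?thesis
    by (simp add: clinear_sum[OF assms] clinear_scale[OF assms])
qed

lemma tr_comp_commute:
  fixes f g :: "complex ^ 'n \<Rightarrow> complex ^ 'n"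
  assumes "clinear f" "clinear g"
  shows "tr (\<lambda>v. f (g v)) = tr (\<lambda>v. g (f v))"
proof -
  have "tr (\<lambda>v. f (g v)) = (\<Sum>i\<in>UNIV. \<Sum>j\<in>UNIV. g (axis i 1) $ j * f (axis j 1) $ i)"
    unfolding tr_def by (simp add: clinear_expand[OF assms(1), of "g _"])
  also have "\<dots> = (\<Sum>j\<in>UNIV. \<Sum>i\<in>UNIV. f (axis j 1) $ i * g (axis i 1) $ j)"
    by (subst sum.swap) (simp add: mult.commute)
  also have "\<dots> = tr (\<lambda>v. g (f v))"
    unfolding tr_def by (simp add: clinear_expand[OF assms(2), of "f _"])
  finally show ?thesis .
qed

text \<open>With p j a projection onto W j, cyclicity of the trace gives
  tr (M p (j+1)) = tr (p j M p (j+1)) = tr (M p (j+1) p j) = tr (M p j).\<close>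
lemma tr_eq_0_if_lowers_flag:
  fixes M :: "complex ^ 'n \<Rightarrow> complex ^ 'n"
  assumes M: "clinear M"
    and sub: "\<And>j. vec.subspace (W j)" and mono: "\<And>j::nat. W j \<subseteq> W (Suc j)"
    and lower: "\<And>j v. v \<in> W (Suc j) \<Longrightarrow> M v \<in> W j"
    and W0: "W 0 = {0}" and Wm: "W m = UNIV"
  shows "tr M = 0"
proof -
  have "\<forall>j. \<exists>\<pi>. clinear \<pi> \<and> (\<forall>v. \<pi> v \<in> W j) \<and> (\<forall>v\<in>W j. \<pi> v = v)"
    by (intro allI projection_exists sub)
  from choice[OF this] obtain p
    where "\<forall>j. clinear (p j) \<and> (\<forall>v. p j v \<in> W j) \<and> (\<forall>v\<in>W j. p j v = v)" ..
  then have p: "\<And>j. clinear (p j)" "\<And>j v. p j v \<in> W j" "\<And>j v. v \<in> W j \<Longrightarrow> p j v = v"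
    by simp_all
  have "tr (\<lambda>v. M (p j v)) = 0" for j
  proof (induction j)
    case 0
    have "p 0 v = 0" for v using p(2)[of 0 v] W0 by auto
    then show ?case by (simp add: clinear_0[OF M] tr_zero)
  next
    case (Suc j)
    have "tr (\<lambda>v. M (p (Suc j) v)) = tr (\<lambda>v. p j (M (p (Suc j) v)))"
      by (simp only: p(3)[OF lower[OF p(2)]])
    also have "\<dots> = tr (\<lambda>v. M (p (Suc j) (p j v)))"
      by (intro tr_comp_commute[of "p j" "\<lambda>v. M (p (Suc j) v)"] clinear_compose[OF M] p)
    also have "\<dots> = tr (\<lambda>v. M (p j v))"
      by (simp only: p(3)[OF subsetD[OF mono p(2)]])
    finally show ?case using Suc by simp
  qed
  from this[of m] show ?thesis by (simp only: p(3) Wm UNIV_I)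
qed

lemma funpow_eq_0_mono:
  assumes "clinear f" "(f ^^ k) v = 0" "k \<le> m"
  shows "(f ^^ m) v = 0"
proof -
  have "(f ^^ m) v = (f ^^ (m - k)) ((f ^^ k) v)"
    using assms(3) by (metis comp_apply funpow_add le_add_diff_inverse2)
  then show ?thesis
    by (simp add: assms(2) clinear_0[OF clinear_funpow[OF assms(1)]])
qed

text \<open>The exponents at the finitely many standard basis vectors have a maximum, and by
  linearity it serves every vector.\<close>

lemma locally_nilpotent_imp_nilpotent:
  fixes f :: "complex ^ 'n \<Rightarrow> complex ^ 'n"
  assumes f: "clinear f" and nil: "\<And>v. \<exists>k. (f ^^ k) v = 0"
  shows "\<exists>k. \<forall>v. (f ^^ k) v = 0"
proof -
  have "\<forall>i. \<exists>k. (f ^^ k) (axis i 1) = 0" using nil by blast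
  from choice[OF this] obtain k where k: "\<And>i. (f ^^ k i) (axis i 1) = 0"
    by blast
  define m where "m = Max (range k)"
  have "(f ^^ m) (axis i 1) = 0" for i
    by (rule funpow_eq_0_mono[OF f k]) (simp add: m_def)
  then have "(f ^^ m) v = 0" for v
    by (subst clinear_expand[OF clinear_funpow[OF f]]) simp
  then show ?thesis by blast
qed

text \<open>The kernels of the powers of \<open>f\<close> form a flag that \<open>f\<close>
  lowers.\<close>

lemma tr_nilpotent:
  fixes f :: "complex ^ 'n \<Rightarrow> complex ^ 'n"
  assumes f: "clinear f" and nil: "\<And>v. (f ^^ k) v = 0"
  shows "tr f = 0"
proof (rule tr_eq_0_if_lowers_flag[where W = "\<lambda>j. {v. (f ^^ j) v = 0}" and m = k])
  show "clinear f" by fact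
  show "vec.subspace {v. (f ^^ j) v = 0}" for j
    by (intro subspace_kernel clinear_funpow f)
  show "{v. (f ^^ j) v = 0} \<subseteq> {v. (f ^^ Suc j) v = 0}" for j
    by (auto simp: clinear_0[OF f])
  show "v \<in> {v. (f ^^ Suc j) v = 0} \<Longrightarrow> f v \<in> {v. (f ^^ j) v = 0}" for j v
    by (simp add: funpow_swap1)
qed (use nil in auto)

text \<open>Because \<open>tr\<close> refers to the standard basis, the eigenbasis enters through
  coordinates: after swapping the sums, the factor of \<open>d v\<close> is the
  \<open>v\<close>-coordinate of \<open>v\<close> itself, which is 1.\<close>

lemma tr_eq_sum_eigenvalues:
  fixes M :: "complex ^ 'n \<Rightarrow> complex ^ 'n"
  assumes M: "clinear M" and b: "vec.independent b" "vec.span b = UNIV"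
    and eig: "\<And>v. v \<in> b \<Longrightarrow> M v = d v *s v"
  shows "tr M = (\<Sum>v\<in>b. d v)"
proof -
  let ?r = "vec.representation b"
  have fin: "finite b" using b(1) by (rule vec.finiteI_independent)
  have expand: "(\<Sum>v\<in>b. ?r w v *s v) = w" for w
    using vec.sum_representation_eq[OF b(1) _ fin] b(2) by auto
  have lin: "Vector_Spaces.linear (*s) (*) (\<lambda>w. ?r w v)" for v
    using vec.linear_representation[OF b] .
  have coord: "(\<Sum>i\<in>UNIV. ?r (axis i 1) v * w $ i) = ?r w v" for v w
  proof -
    have "?r w v = ?r (\<Sum>i\<in>UNIV. w $ i *s axis i 1) v"
      by (simp add: basis_expansion)
    also have "\<dots> = (\<Sum>i\<in>UNIV. w $ i * ?r (axis i 1) v)"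
      using lin[of v] unfolding Vector_Spaces.linear_iff
      by (simp add: module_hom.sum[OF Vector_Spaces.linear.axioms(3)[OF lin]])
    finally show ?thesis by (simp add: mult.commute)
  qed
  have "M w = (\<Sum>v\<in>b. ?r w v *s (d v *s v))" for w
    by (subst expand[of w, symmetric]) (simp add: clinear_sum[OF M] clinear_scale[OF M] eig)
  then have "tr M = (\<Sum>i\<in>UNIV. \<Sum>v\<in>b. d v * (?r (axis i 1) v * v $ i))"
    unfolding tr_def by (simp add: ac_simps)
  also have "\<dots> = (\<Sum>v\<in>b. d v * ?r v v)"
    by (subst sum.swap) (simp add: coord flip: sum_distrib_left)
  also have "\<dots> = (\<Sum>v\<in>b. d v)"
    by (intro sum.cong) (simp_all add: vec.representation_basis[OF b(1)])
  finally show ?thesis .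
qed

section \<open>Generalized eigenspaces\<close>

definition shift :: "(complex ^ 'n \<Rightarrow> complex ^ 'n) \<Rightarrow> complex \<Rightarrow> complex ^ 'n \<Rightarrow> complex ^ 'n" where
  "shift U l v = U v - l *s v"

text \<open>For linear \<open>U\<close> and \<open>l\<close> not an eigenvalue this is
  \<open>{0}\<close>, so unions may range over all complex \<open>l\<close>.\<close>

definition gen_eigenspace :: "(complex ^ 'n \<Rightarrow> complex ^ 'n) \<Rightarrow> complex \<Rightarrow> (complex ^ 'n) set" where
  "gen_eigenspace U l = {v. \<exists>k. (shift U l ^^ k) v = 0}"

lemma clinear_shift: "clinear U \<Longrightarrow> clinear (shift U l)"
  unfolding shift_def by (intro clinear_intros)

lemma subspace_gen_eigenspace:
  assumes "clinear U"
  shows "vec.subspace (gen_eigenspace U l)"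
proof -
  note lin = clinear_funpow[OF clinear_shift[OF assms]]
  have "\<exists>k. (shift U l ^^ k) (v + w) = 0"
    if "(shift U l ^^ i) v = 0" "(shift U l ^^ j) w = 0" for i j v w
    using funpow_eq_0_mono[OF clinear_shift[OF assms] that(1), of "i + j"]
      funpow_eq_0_mono[OF clinear_shift[OF assms] that(2), of "i + j"]
    by (intro exI[of _ "i + j"]) (simp add: clinear_add[OF lin])
  then show ?thesis
    unfolding vec.subspace_def gen_eigenspace_def
    by (auto simp: clinear_scale[OF lin] clinear_0[OF lin])
qed

lemma shift_in_gen_eigenspace:
  assumes "clinear U" "v \<in> gen_eigenspace U l"
  shows "shift U m v \<in> gen_eigenspace U l"
proof -
  obtain k where "(shift U l ^^ k) v = 0"
    using assms(2) unfolding gen_eigenspace_def by blast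
  then have "(shift U l ^^ k) (shift U l v) = 0"
    by (simp add: clinear_0[OF clinear_shift[OF assms(1)]] flip: funpow_swap1)
  then have "shift U l v \<in> gen_eigenspace U l"
    unfolding gen_eigenspace_def by blast
  then have "shift U l v + (l - m) *s v \<in> gen_eigenspace U l"
    by (intro vec.subspace_add vec.subspace_scale subspace_gen_eigenspace assms)
  then show ?thesis
    by (simp add: shift_def algebra_simps)
qed

lemma in_gen_eigenspace_if_shift_in:
  assumes "shift U l v \<in> gen_eigenspace U l"
  shows "v \<in> gen_eigenspace U l"
proof -
  obtain k where "(shift U l ^^ k) (shift U l v) = 0"
    using assms unfolding gen_eigenspace_def by blast
  then have "(shift U l ^^ Suc k) v = 0" by (simp add: funpow_swap1)
  then show ?thesis unfolding gen_eigenspace_def by blast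
qed

text \<open>On the kernel of \<open>shift U m\<close>, the map \<open>shift U l\<close> is
  multiplication by the nonzero scalar \<open>m - l\<close>, so its powers kill only zero
  there.\<close>

lemma shift_inj_on_gen_eigenspace:
  assumes U: "clinear U" and "l \<noteq> m" and v: "v \<in> gen_eigenspace U l" and "shift U m v = 0"
  shows "v = 0"
proof -
  have eig: "shift U l v = (m - l) *s v"
    using \<open>shift U m v = 0\<close> by (simp add: shift_def)
  have pow: "(shift U l ^^ k) v = (m - l) ^ k *s v" for k
  proof (induction k)
    case (Suc k)
    have "(shift U l ^^ Suc k) v = (m - l) ^ k *s shift U l v"
      by (simp add: Suc clinear_scale[OF clinear_shift[OF U]])
    also have "\<dots> = (m - l) ^ Suc k *s v"
      unfolding eig by (simp only: vec.scale_scale power_Suc mult.commute)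
    finally show ?case .
  qed simp
  obtain k where "(shift U l ^^ k) v = 0"
    using v unfolding gen_eigenspace_def by blast
  then show ?thesis using \<open>l \<noteq> m\<close> unfolding pow by simp
qed

lemma funpow_shift_inj_on_gen_eigenspace:
  assumes U: "clinear U" and "l \<noteq> m"
  shows "v \<in> gen_eigenspace U l \<Longrightarrow> (shift U m ^^ k) v = 0 \<Longrightarrow> v = 0"
proof (induction k arbitrary: v)
  case (Suc k)
  have "shift U m v = 0"
    by (rule Suc.IH[OF shift_in_gen_eigenspace[OF U Suc.prems(1)]])
      (use Suc.prems(2) in \<open>simp add: funpow_swap1\<close>)
  then show ?case
    by (rule shift_inj_on_gen_eigenspace[OF assms Suc.prems(1)])
qed simp

text \<open>Induction on the exponent of \<open>w\<close>: as \<open>shift U m\<close> is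
  \<open>shift U l\<close> plus the scalar \<open>l - m\<close>, the multiple of \<open>w\<close> by
  \<open>l - m\<close> equals \<open>shift U m w\<close> minus \<open>shift U l w\<close>, and the
  latter has a smaller exponent and hence a preimage.\<close>

lemma shift_surj_on_gen_eigenspace:
  assumes U: "clinear U" and "l \<noteq> m" and "w \<in> gen_eigenspace U l"
  shows "\<exists>v\<in>gen_eigenspace U l. shift U m v = w"
proof -
  obtain k where "(shift U l ^^ k) w = 0"
    using assms(3) unfolding gen_eigenspace_def by blast
  then show ?thesis using assms(3)
  proof (induction k arbitrary: w)
    case 0
    then show ?case by (intro bexI[of _ w]) (simp_all add: clinear_0[OF clinear_shift[OF U]])
  next
    case (Suc k)
    obtain v where v: "v \<in> gen_eigenspace U l" "shift U m v = shift U l w"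
      using Suc.IH[of "shift U l w"] Suc.prems shift_in_gen_eigenspace[OF U]
      by (auto simp: funpow_swap1)
    have "shift U m ((1 / (l - m)) *s (w - v)) = (1 / (l - m)) *s (shift U m w - shift U l w)"
      by (simp only: clinear_scale[OF clinear_shift[OF U]] clinear_diff[OF clinear_shift[OF U]] v(2))
    also have "shift U m w - shift U l w = (l - m) *s w"
      by (simp add: shift_def)
    also have "(1 / (l - m)) *s ((l - m) *s w) = w"
      using \<open>l \<noteq> m\<close> by (simp only: vec.scale_scale) simp
    finally have "shift U m ((1 / (l - m)) *s (w - v)) = w" .
    moreover have "(1 / (l - m)) *s (w - v) \<in> gen_eigenspace U l"
      using subspace_gen_eigenspace[OF U] Suc.prems(2) v(1)
      by (intro vec.subspace_scale vec.subspace_diff)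
    ultimately show ?case by blast
  qed
qed

text \<open>Generalized eigenspaces are independent: a power of \<open>shift U a\<close> that kills
  the \<open>a\<close>-component is injective on the others, so the induction hypothesis applies to
  the shorter sum of images.\<close>

lemma gen_eigenspace_sum_eq_0:
  assumes U: "clinear U" and "finite F"
  shows "(\<And>l. l \<in> F \<Longrightarrow> v l \<in> gen_eigenspace U l) \<Longrightarrow> (\<Sum>l\<in>F. v l) = 0 \<Longrightarrow> m \<in> F \<Longrightarrow> v m = 0"
  using \<open>finite F\<close>
proof (induction F arbitrary: v m rule: finite_induct)
  case (insert a F)
  obtain k where k: "(shift U a ^^ k) (v a) = 0"
    using insert.prems(1) unfolding gen_eigenspace_def by blast
  note lin = clinear_funpow[OF clinear_shift[OF U], of k a]
  have stay: "(shift U a ^^ j) w \<in> gen_eigenspace U l" if "w \<in> gen_eigenspace U l" for j l w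
    using that by (induction j) (auto intro: shift_in_gen_eigenspace[OF U])
  have "(shift U a ^^ k) (\<Sum>l\<in>insert a F. v l) = (\<Sum>l\<in>F. (shift U a ^^ k) (v l))"
    using insert.hyps k by (simp add: clinear_add[OF lin] clinear_sum[OF lin])
  then have sum0: "(\<Sum>l\<in>F. (shift U a ^^ k) (v l)) = 0"
    using insert.prems(2) by (simp add: clinear_0[OF lin])
  have kill: "(shift U a ^^ k) (v l) = 0" if "l \<in> F" for l
    by (rule insert.IH[of "\<lambda>l. (shift U a ^^ k) (v l)", OF stay[OF insert.prems(1)] sum0 that]) simp
  have *: "v l = 0" if "l \<in> F" for l
    by (rule funpow_shift_inj_on_gen_eigenspace[OF U _ insert.prems(1) kill[OF that]])
      (use that insert.hyps(2) in auto)
  have "(\<Sum>l\<in>F. v l) = 0" by (rule sum.neutral) (use * in blast)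
  then have "v a = 0" using insert.prems(2) insert.hyps by simp
  then show ?case using * insert.prems(3) by auto
qed simp

section \<open>Polynomials in an operator and the spanning of the space by generalized
  eigenspaces\<close>

definition op_poly :: "(complex ^ 'n \<Rightarrow> complex ^ 'n) \<Rightarrow> complex poly \<Rightarrow> complex ^ 'n \<Rightarrow> complex ^ 'n" where
  "op_poly U p v = (\<Sum>i\<le>degree p. coeff p i *s (U ^^ i) v)"

lemma op_poly_eq:
  assumes "degree p \<le> n"
  shows "op_poly U p v = (\<Sum>i\<le>n. coeff p i *s (U ^^ i) v)"
  unfolding op_poly_def using assms
  by (intro sum.mono_neutral_left) (auto simp: coeff_eq_0)

lemma op_poly_linear_factor:
  assumes U: "clinear U"
  shows "op_poly U ([:- a, 1:] * q) v = shift U a (op_poly U q v)"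
proof -
  have deg: "degree ([:- a, 1:] * q) \<le> Suc (degree q)"
    by (intro order.trans[OF degree_mult_le]) simp
  have c: "coeff ([:- a, 1:] * q) i = coeff (pCons 0 q) i - a * coeff q i" for i
    by simp
  \<comment> \<open>Both sums run one past the degree of \<open>q\<close>: the first because
    multiplication by the variable shifts the coefficients up, the second at the cost of a zero
    term.\<close>
  have "op_poly U ([:- a, 1:] * q) v
      = (\<Sum>i\<le>Suc (degree q). coeff (pCons 0 q) i *s (U ^^ i) v)
        - a *s (\<Sum>i\<le>Suc (degree q). coeff q i *s (U ^^ i) v)"
    unfolding op_poly_eq[OF deg] c
    by (simp only: vec.scale_left_diff_distrib sum_subtractf vec.scale_sum_right vec.scale_scale)
  also have "(\<Sum>i\<le>Suc (degree q). coeff (pCons 0 q) i *s (U ^^ i) v) = U (op_poly U q v)"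
    unfolding op_poly_def
    by (subst sum.atMost_Suc_shift) (simp add: clinear_sum[OF U] clinear_scale[OF U])
  also have "(\<Sum>i\<le>Suc (degree q). coeff q i *s (U ^^ i) v) = op_poly U q v"
    by (rule op_poly_eq[symmetric]) simp
  finally show ?thesis by (simp add: shift_def)
qed

text \<open>The vectors \<open>v\<close>, \<open>U v\<close>, ..., up to the power \<open>n\<close>
  equal to the dimension, are one too many to be independent.\<close>

lemma annihilating_poly_exists:
  fixes v :: "complex ^ 'n"
  shows "\<exists>p. p \<noteq> 0 \<and> op_poly U p v = 0"
proof -
  define n where "n = vec.dim (UNIV :: (complex ^ 'n) set)"
  define w where "w i = (U ^^ i) v" for i
  have "\<exists>c. (\<exists>i\<le>n. c i \<noteq> 0) \<and> (\<Sum>i\<le>n. c i *s w i) = 0"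
  \<comment> \<open>Independence concerns sets, so a repetition in the family is handled apart, with
    coefficients 1 and -1.\<close>
  proof (cases "inj_on w {..n}")
    case True
    have "\<not> vec.independent (w ` {..n})"
      using vec.independent_card_le_dim[of "w ` {..n}" UNIV] True
      by (auto simp: card_image n_def)
    then obtain u where u: "\<exists>x\<in>w ` {..n}. u x \<noteq> 0" "(\<Sum>x\<in>w ` {..n}. u x *s x) = 0"
      using vec.dependent_finite[of "w ` {..n}"] by auto
    then show ?thesis
      by (intro exI[of _ "\<lambda>i. u (w i)"]) (auto simp: sum.reindex[OF True])
  next
    case False
    then obtain i j where ij: "i \<le> n" "j \<le> n" "i \<noteq> j" "w i = w j"
      by (auto simp: inj_on_def)
    let ?c = "\<lambda>k. if k = i then 1 else if k = j then - 1 else 0 :: complex"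
    have "(\<Sum>k\<le>n. ?c k *s w k) = (\<Sum>k\<in>{i, j}. ?c k *s w k)"
      using ij by (intro sum.mono_neutral_right) auto
    also have "\<dots> = 0" using ij by (simp add: vec.scale_minus_left)
    finally show ?thesis using ij(1) by (intro exI[of _ ?c]) auto
  qed
  then obtain c i where c: "i \<le> n" "c i \<noteq> 0" "(\<Sum>i\<le>n. c i *s w i) = 0"
    by blast
  define p where "p = (\<Sum>i\<le>n. monom (c i) i)"
  have co: "coeff p k = (if k \<le> n then c k else 0)" for k
    by (simp add: p_def coeff_sum)
  then have "degree p \<le> n" by (intro degree_le) auto
  then have "op_poly U p v = 0"
    using c(3) by (simp add: op_poly_eq co w_def)
  moreover have "p \<noteq> 0" using co[of i] c by auto
  ultimately show ?thesis by blast
qed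

text \<open>Take a nonzero polynomial \<open>p\<close> of least degree that carries \<open>v\<close>
  into \<open>E\<close>. It is not constant, and splitting off a root \<open>l\<close> leaves a
  factor \<open>q\<close> of smaller degree, so \<open>op_poly U q v\<close> is outside
  \<open>E\<close> while \<open>shift U l\<close> maps it into \<open>E\<close>.\<close>

lemma eigenvector_mod_subspace_exists:
  fixes E :: "(complex ^ 'n) set"
  assumes U: "clinear U" and E: "vec.subspace E" "E \<noteq> UNIV"
  shows "\<exists>l v. v \<notin> E \<and> shift U l v \<in> E"
proof -
  obtain v where v: "v \<notin> E" using E by blast
  let ?P = "\<lambda>p. p \<noteq> 0 \<and> op_poly U p v \<in> E"
  have "\<exists>p. ?P p"
    using annihilating_poly_exists[of U v] vec.subspace_0[OF E(1)] by metis
  then obtain p where p: "?P p" and min: "\<And>q. ?P q \<Longrightarrow> degree p \<le> degree q"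
    using ex_has_least_nat[of ?P _ degree] by blast
  have "degree p \<noteq> 0"
  proof
    assume "degree p = 0"
    then have "coeff p 0 *s v \<in> E" "coeff p 0 \<noteq> 0"
      using p leading_coeff_0_iff[of p] by (auto simp: op_poly_def)
    then have "(1 / coeff p 0) *s (coeff p 0 *s v) \<in> E"
      by (metis vec.subspace_scale[OF E(1)])
    then show False using v \<open>coeff p 0 \<noteq> 0\<close> by simp
  qed
  then obtain l where "poly p l = 0"
    using fundamental_theorem_of_algebra[of p] constant_degree[of p] by auto
  then obtain q where q: "p = [:- l, 1:] * q"
    by (auto simp: poly_eq_0_iff_dvd elim: dvdE)
  then have "q \<noteq> 0" using p by auto
  then have "degree q < degree p"
    unfolding q by (subst degree_mult_eq) auto
  then have "op_poly U q v \<notin> E"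
    using min[of q] \<open>q \<noteq> 0\<close> by auto
  moreover have "shift U l (op_poly U q v) \<in> E"
    using p op_poly_linear_factor[OF U] unfolding q by metis
  ultimately show ?thesis by blast
qed

text \<open>If the span were proper, some \<open>v\<close> outside would have
  \<open>shift U l v\<close> inside. By surjectivity on the other generalized eigenspaces,
  \<open>shift U l v\<close> differs from some \<open>shift U l b\<close>, with \<open>b\<close> in
  the span, by an element of the generalized \<open>l\<close>-eigenspace. Then \<open>v - b\<close>
  lies in that eigenspace, a contradiction.\<close>

lemma span_gen_eigenspaces:
  fixes U :: "complex ^ 'n \<Rightarrow> complex ^ 'n"
  assumes U: "clinear U"
  shows "vec.span (\<Union>l. gen_eigenspace U l) = UNIV" (is "?E = _")
proof (rule ccontr)
  assume "?E \<noteq> UNIV"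
  then obtain l v where v: "v \<notin> ?E" "shift U l v \<in> ?E"
    using eigenvector_mod_subspace_exists[OF U, of ?E] by auto
  have split: "\<exists>a b. w = a + shift U l b \<and> a \<in> gen_eigenspace U l \<and> b \<in> ?E" if "w \<in> ?E" for w
    using that
  proof (induction rule: vec.span_induct_alt)
    case base
    show ?case
      using vec.subspace_0[OF subspace_gen_eigenspace[OF U]]
      by (intro exI[of _ 0]) (simp add: vec.span_zero clinear_0[OF clinear_shift[OF U]])
  next
    case (step c x y)
    obtain a b where ab: "y = a + shift U l b" "a \<in> gen_eigenspace U l" "b \<in> ?E"
      using step by blast
    obtain m where m: "x \<in> gen_eigenspace U m" using step by blast
    show ?case
    proof (cases "m = l")
      case True
      then have "c *s x + a \<in> gen_eigenspace U l"
        using m ab(2) subspace_gen_eigenspace[OF U] unfolding vec.subspace_def by blast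
      then show ?thesis using ab
        by (intro exI[of _ "c *s x + a"] exI[of _ b]) (simp add: add.assoc)
    next
      case False
      then obtain z where z: "z \<in> gen_eigenspace U m" "shift U l z = x"
        using shift_surj_on_gen_eigenspace[OF U _ m] by blast
      then have "z \<in> ?E" by (blast intro: vec.span_base)
      then show ?thesis using ab z
        by (intro exI[of _ a] exI[of _ "c *s z + b"])
          (simp add: clinear_add[OF clinear_shift[OF U]] clinear_scale[OF clinear_shift[OF U]]
            vec.span_add vec.span_scale)
    qed
  qed
  obtain a b where ab: "shift U l v = a + shift U l b" "a \<in> gen_eigenspace U l" "b \<in> ?E"
    using split[OF v(2)] by blast
  then have "shift U l (v - b) \<in> gen_eigenspace U l"
    by (simp add: clinear_diff[OF clinear_shift[OF U]])
  then have "v - b \<in> ?E"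
    by (blast intro: vec.span_base in_gen_eigenspace_if_shift_in)
  then have "v - b + b \<in> ?E" using ab(3) by (rule vec.span_add)
  then show False using v(1) by simp
qed

section \<open>Linear maps prescribed on generalized eigenspaces\<close>

lemma clinear_eq_if_eq_on_gen_eigenspaces:
  fixes U :: "complex ^ 'n \<Rightarrow> complex ^ 'n"
  assumes "clinear U" "clinear f" "clinear g"
    and "\<And>l v. v \<in> gen_eigenspace U l \<Longrightarrow> f v = g v"
  shows "f v = g v"
  by (rule clinear_eq_on_span[OF assms(2,3), of "\<Union>l. gen_eigenspace U l"])
    (use assms(4) span_gen_eigenspaces[OF assms(1)] in auto)

lemma gen_eigenspace_basis_exists:
  fixes U :: "complex ^ 'n \<Rightarrow> complex ^ 'n"
  assumes U: "clinear U"
  obtains b ev where "vec.independent b" "vec.span b = UNIV"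
    "\<And>v. v \<in> b \<Longrightarrow> v \<in> gen_eigenspace U (ev v)"
proof -
  obtain b where b: "b \<subseteq> (\<Union>l. gen_eigenspace U l)" "vec.independent b"
      "(\<Union>l. gen_eigenspace U l) \<subseteq> vec.span b"
    using vec.maximal_independent_subset by blast
  have sp: "vec.span b = UNIV"
    using vec.span_mono[OF b(3)] span_gen_eigenspaces[OF U] by (simp add: vec.span_span top.extremum_unique)
  have "\<forall>v\<in>b. \<exists>l. v \<in> gen_eigenspace U l" using b(1) by blast
  from bchoice[OF this] obtain ev where "\<And>v. v \<in> b \<Longrightarrow> v \<in> gen_eigenspace U (ev v)"
    by blast
  then show thesis using that b(2) sp by blast
qed

text \<open>The map is prescribed on a basis of generalized eigenvectors. By independence of the
  eigenspaces, a vector of the generalized \<open>l\<close>-eigenspace involves only the basis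
  vectors with label \<open>l\<close>.\<close>

lemma spectral_map_exists:
  fixes U :: "complex ^ 'n \<Rightarrow> complex ^ 'n"
  assumes U: "clinear U"
  shows "\<exists>S. clinear S \<and> (\<forall>l. \<forall>v\<in>gen_eigenspace U l. S v = \<phi> l *s v)"
proof -
  obtain b ev where b: "vec.independent b" "vec.span b = UNIV"
      and ev: "\<And>v. v \<in> b \<Longrightarrow> v \<in> gen_eigenspace U (ev v)"
    using gen_eigenspace_basis_exists[OF U] by blast
  have fin: "finite b" using b(1) by (rule vec.finiteI_independent)
  obtain S where S: "clinear S" "\<And>v. v \<in> b \<Longrightarrow> S v = \<phi> (ev v) *s v"
    using vec.linear_independent_extend[OF b(1), of "\<lambda>v. \<phi> (ev v) *s v"]
    unfolding clinear_def by blast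
  have "S v = \<phi> l *s v" if v: "v \<in> gen_eigenspace U l" for l v
  proof -
    define c where "c = vec.representation b v"
    define w where "w m = (\<Sum>x\<in>{x \<in> b. ev x = m}. c x *s x)" for m
    have "v = (\<Sum>x\<in>b. c x *s x)"
      using vec.sum_representation_eq[OF b(1) _ fin, of v] b(2) by (simp add: c_def)
    \<comment> \<open>The index \<open>l\<close> is inserted because it may fail to be a label of
      any basis vector.\<close>
    also have "\<dots> = (\<Sum>m\<in>insert l (ev ` b). w m)"
      unfolding w_def using fin by (intro sum.group[symmetric]) auto
    finally have vw: "(\<Sum>m\<in>insert l (ev ` b). w m) = v" by simp
    have w: "w m \<in> gen_eigenspace U m" for m
      unfolding w_def using ev subspace_gen_eigenspace[OF U]
      by (intro vec.subspace_sum vec.subspace_scale) auto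
    let ?u = "\<lambda>m. w m - (if m = l then v else 0)"
    have "?u l = 0"
    proof (rule gen_eigenspace_sum_eq_0[OF U, of "insert l (ev ` b)" ?u])
      show "finite (insert l (ev ` b))" using fin by simp
      show "?u m \<in> gen_eigenspace U m" for m
        using w[of m] v vec.subspace_diff[OF subspace_gen_eigenspace[OF U]] by auto
      have "(\<Sum>m\<in>insert l (ev ` b). if m = l then v else 0) = v"
        using fin by (subst sum.delta) auto
      then show "(\<Sum>m\<in>insert l (ev ` b). ?u m) = 0"
        unfolding sum_subtractf vw by simp
    qed simp
    then have "v = w l" by simp
    then have "S v = (\<Sum>x\<in>{x \<in> b. ev x = l}. \<phi> l *s (c x *s x))"
      by (simp add: w_def clinear_sum[OF S(1)] clinear_scale[OF S(1)] S(2) mult.commute)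
    also have "\<dots> = \<phi> l *s w l"
      unfolding w_def by (rule vec.scale_sum_right[symmetric])
    finally show ?thesis using \<open>v = w l\<close> by simp
  qed
  then show ?thesis using S(1) by blast
qed

text \<open>For linear \<open>U\<close> this is \<open>\<phi>\<close> applied to the diagonalizable
  part of \<open>U\<close>; with \<open>\<phi>\<close> equal to \<open>cnj\<close> and
  \<open>U\<close> equal to \<open>B y\<close> it is the map S(y).\<close>

definition spectral_map :: "(complex \<Rightarrow> complex) \<Rightarrow> (complex ^ 'n \<Rightarrow> complex ^ 'n) \<Rightarrow> complex ^ 'n \<Rightarrow> complex ^ 'n" where
  "spectral_map \<phi> U = (SOME S. clinear S \<and> (\<forall>l. \<forall>v\<in>gen_eigenspace U l. S v = \<phi> l *s v))"

lemma
  assumes "clinear U"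
  shows clinear_spectral_map: "clinear (spectral_map \<phi> U)"
    and spectral_map_eq: "v \<in> gen_eigenspace U l \<Longrightarrow> spectral_map \<phi> U v = \<phi> l *s v"
  using someI_ex[OF spectral_map_exists[OF assms, of \<phi>]] unfolding spectral_map_def by blast+

text \<open>The trace in question is the sum of the squared moduli of the eigenvalues of \<^term>\<open>U\<close>.\<close>
lemma nilpotent_if_tr_conj_spectral_map_eq_0:
  fixes U :: "complex ^ 'n \<Rightarrow> complex ^ 'n"
  assumes U: "clinear U" and tr0: "tr (\<lambda>v. spectral_map cnj U (U v)) = 0"
  shows "\<exists>k. \<forall>v. (U ^^ k) v = 0"
proof -
  let ?C = "spectral_map cnj U"
  let ?M = "spectral_map (\<lambda>l. l * cnj l) U"
  \<comment> \<open>On the generalized \<open>l\<close>-eigenspace \<open>?N\<close> is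
    \<open>shift U l\<close> scaled by \<open>cnj l\<close>, hence nilpotent. So the given trace
    equals that of the diagonalizable map \<open>?M\<close>.\<close>
  let ?N = "\<lambda>v. ?C (U v) - ?M v"
  obtain b ev where b: "vec.independent b" "vec.span b = UNIV"
      "\<And>v. v \<in> b \<Longrightarrow> v \<in> gen_eigenspace U (ev v)"
    using gen_eigenspace_basis_exists[OF U] by blast
  have fin: "finite b" using b(1) by (rule vec.finiteI_independent)
  note lin = clinear_spectral_map[OF U]
  have N: "clinear ?N" by (intro clinear_sub clinear_compose[OF lin] lin U)
  have N_eq: "?N v = cnj l *s shift U l v" if "v \<in> gen_eigenspace U l" for l v
  proof -
    have "U v \<in> gen_eigenspace U l"
      using shift_in_gen_eigenspace[OF U that, of 0] by (simp add: shift_def)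
    then show ?thesis
      by (simp add: spectral_map_eq[OF U that] spectral_map_eq[OF U, of "U v" l] shift_def
          vec.scale_right_diff_distrib mult.commute)
  qed
  have N_pow: "(?N ^^ k) v = cnj l ^ k *s (shift U l ^^ k) v" if "v \<in> gen_eigenspace U l" for k l v
    using that
  proof (induction k arbitrary: v)
    case (Suc k)
    have "(?N ^^ Suc k) v = (?N ^^ k) (cnj l *s shift U l v)"
      unfolding N_eq[OF Suc.prems, symmetric] funpow_Suc_right by simp
    also have "\<dots> = cnj l *s (?N ^^ k) (shift U l v)"
      by (rule clinear_scale[OF clinear_funpow[OF N]])
    also have "\<dots> = cnj l ^ Suc k *s (shift U l ^^ Suc k) v"
      using Suc.IH[OF shift_in_gen_eigenspace[OF U Suc.prems]] by (simp add: funpow_swap1)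
    finally show ?case .
  qed simp
  have sub0: "vec.subspace {v. \<exists>k. (?N ^^ k) v = 0}"
    using subspace_gen_eigenspace[OF N, of 0] by (simp add: gen_eigenspace_def shift_def[abs_def])
  have "\<exists>k. (?N ^^ k) v = 0" if "v \<in> (\<Union>l. gen_eigenspace U l)" for v
    using that N_pow by (force simp: gen_eigenspace_def)
  then have "\<exists>k. (?N ^^ k) v = 0" for v
    using vec.span_minimal[OF _ sub0, of "\<Union>l. gen_eigenspace U l"] span_gen_eigenspaces[OF U]
    by blast
  then obtain k where "\<And>v. (?N ^^ k) v = 0"
    using locally_nilpotent_imp_nilpotent[OF N] by blast
  then have "tr ?N = 0" using tr_nilpotent[OF N] by blast
  then have "tr ?M = 0" using tr0 by (simp add: tr_diff)
  moreover have "tr ?M = (\<Sum>v\<in>b. ev v * cnj (ev v))"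
    by (intro tr_eq_sum_eigenvalues lin b(1,2)) (use b(3) spectral_map_eq[OF U] in auto)
  ultimately have "complex_of_real (\<Sum>v\<in>b. (cmod (ev v))\<^sup>2) = 0"
    by (simp only: of_real_sum complex_norm_square)
  then have "(\<Sum>v\<in>b. (cmod (ev v))\<^sup>2) = 0" by (simp only: of_real_eq_0_iff)
  then have "ev v = 0" if "v \<in> b" for v
    using that fin by (simp add: sum_nonneg_eq_0_iff)
  then have "b \<subseteq> gen_eigenspace U 0" using b(3) by (metis subsetI)
  then have "gen_eigenspace U 0 = UNIV"
    using vec.span_minimal[OF _ subspace_gen_eigenspace[OF U]] b(2) by blast
  then have "\<exists>k. (U ^^ k) v = 0" for v
    by (auto simp: gen_eigenspace_def shift_def[abs_def])
  then show ?thesis using locally_nilpotent_imp_nilpotent[OF U] by blast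
qed

section \<open>Lie algebras and the Killing form\<close>

text \<open>The flag for Engel's theorem in a canonical form: it depends on \<open>J\<close> alone,
  so an algebra having \<open>J\<close> as an ideal preserves each step.\<close>

primrec ad_flag :: "(complex ^ 'n \<Rightarrow> complex ^ 'n \<Rightarrow> complex ^ 'n) \<Rightarrow> (complex ^ 'n) set \<Rightarrow> nat \<Rightarrow> (complex ^ 'n) set" where
  "ad_flag B J 0 = {0}"
| "ad_flag B J (Suc j) = {v. \<forall>u\<in>J. B u v \<in> ad_flag B J j}"

locale lie_bracket =
  fixes B :: "complex ^ 'n \<Rightarrow> complex ^ 'n \<Rightarrow> complex ^ 'n"
  assumes lie: "lie_algebra B"
begin

lemma ad: "clinear (B x)"
  and ad_left: "clinear (\<lambda>x. B x y)"
  and bracket_self: "B x x = 0"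
  using lie unfolding lie_algebra_def by auto

lemmas bracket_simps = clinear_add[OF ad] clinear_add[OF ad_left] clinear_scale[OF ad]
  clinear_scale[OF ad_left] clinear_diff[OF ad] clinear_diff[OF ad_left]
  clinear_minus[OF ad] clinear_minus[OF ad_left] clinear_0[OF ad] clinear_0[OF ad_left]

lemma antisym: "B x y = - B y x"
proof -
  have "B (x + y) (x + y) = B x y + B y x"
    by (simp only: bracket_simps) (simp add: bracket_self)
  then have "B x y + B y x = 0" by (simp only: bracket_self)
  then show ?thesis by (simp only: eq_neg_iff_add_eq_0)
qed

lemma jacobi: "B a (B b c) = B (B a b) c + B b (B a c)"
proof -
  have "B a (B b c) + B b (B c a) + B c (B a b) = 0"
    using lie unfolding lie_algebra_def by blast
  moreover have "B b (B c a) = - B b (B a c)"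
    using antisym[of c a] by (simp add: bracket_simps)
  moreover have "B c (B a b) = - B (B a b) c" by (rule antisym)
  ultimately show ?thesis by (simp add: algebra_simps)
qed

lemma ad_bracket: "B (B a b) w = B a (B b w) - B b (B a w)"
  by (simp add: jacobi[of a b])

section \<open>The Killing form\<close>

definition kf :: "complex ^ 'n \<Rightarrow> complex ^ 'n \<Rightarrow> complex" where
  "kf u v = tr (\<lambda>w. B u (B v w))"

lemma kf_sym: "kf u v = kf v u"
  unfolding kf_def by (rule tr_comp_commute[OF ad ad])

lemma kf_add_left: "kf (u + u') v = kf u v + kf u' v"
  and kf_diff_left: "kf (u - u') v = kf u v - kf u' v"
  and kf_scale_left: "kf (c *s u) v = c * kf u v"
  and kf_zero_left: "kf 0 v = 0"
  unfolding kf_def by (simp_all only: bracket_simps tr_add tr_diff tr_scale tr_zero)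

lemma kf_add_right: "kf v (u + u') = kf v u + kf v u'"
  and kf_scale_right: "kf v (c *s u) = c * kf v u"
  by (simp_all only: kf_sym[of v] kf_add_left kf_scale_left)

lemma kf_invariant: "kf (B a b) c = kf a (B b c)"
proof -
  have "tr (\<lambda>w. B b (B a (B c w))) = tr (\<lambda>w. B a (B c (B b w)))"
    by (rule tr_comp_commute[OF ad clinear_compose[OF ad ad]])
  then show ?thesis
    unfolding kf_def by (simp only: ad_bracket bracket_simps tr_diff)
qed

text \<open>Orthogonality refers to the Killing form of the whole algebra, not to that of
  \<open>c\<close>.\<close>

definition orth :: "(complex ^ 'n) set \<Rightarrow> (complex ^ 'n) set" where
  "orth c = {u. \<forall>v\<in>c. kf u v = 0}"

lemma subspace_orth: "vec.subspace (orth c)"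
  unfolding vec.subspace_def orth_def by (simp add: kf_add_left kf_scale_left kf_zero_left)

lemma orth_bracket:
  assumes "lie_subalgebra B c" "a \<in> c" "u \<in> orth c"
  shows "B a u \<in> orth c"
proof -
  have "kf (B a u) v = 0" if "v \<in> c" for v
  proof -
    have "kf (B a u) v = kf u (B v a)"
      by (rule trans[OF kf_sym trans[OF kf_invariant[symmetric] kf_sym]])
    moreover have "B v a \<in> c" using assms that unfolding lie_subalgebra_def by blast
    ultimately show ?thesis using assms(3) unfolding orth_def by simp
  qed
  then show ?thesis unfolding orth_def by blast
qed

text \<open>The trace is that of the square of \<open>B u\<close>, which is nilpotent.\<close>

lemma kf_nilpotent_self:
  assumes "nilpotent_elt B u"
  shows "kf u u = 0"
proof -
  obtain k where k: "\<And>w. (B u ^^ k) w = 0"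
    using assms unfolding nilpotent_elt_def by blast
  have comm: "((\<lambda>w. B u (B u w)) ^^ j) w = (B u ^^ j) ((B u ^^ j) w)" for j w
    by (induction j) (simp_all add: funpow_swap1)
  show ?thesis
    unfolding kf_def
    by (rule tr_nilpotent[where k = k, OF clinear_compose[OF ad ad]])
      (simp add: comm k clinear_0[OF clinear_funpow[OF ad]])
qed

subsection \<open>Engel's theorem\<close>

text \<open>Engel's theorem for \<open>J\<close> acting on \<open>V\<close> modulo \<open>W\<close>,
  stated without quotient spaces. Induct on the dimension of \<open>J\<close>, using a proper
  subalgebra \<open>K\<close> of largest dimension.\<close>

lemma engel:
  assumes "lie_subalgebra B J" "\<And>u. u \<in> J \<Longrightarrow> nilpotent_elt B u"
    and "vec.subspace W" "vec.subspace V" "W \<subset> V"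
    and "\<And>u v. u \<in> J \<Longrightarrow> v \<in> W \<Longrightarrow> B u v \<in> W" "\<And>u v. u \<in> J \<Longrightarrow> v \<in> V \<Longrightarrow> B u v \<in> V"
  shows "\<exists>v\<in>V - W. \<forall>u\<in>J. B u v \<in> W"
  using assms
proof (induction "vec.dim J" arbitrary: J W V rule: less_induct)
  case less
  note J = less.prems(1) and nil = less.prems(2) and W = less.prems(3) and V = less.prems(4)
    and WV = less.prems(5) and stW = less.prems(6) and stV = less.prems(7)
  have Jsub: "vec.subspace J" using J unfolding lie_subalgebra_def by blast
  show ?case
  proof (cases "J = {0}")
    case True
    obtain v where "v \<in> V - W" using WV by blast
    then show ?thesis
      using True vec.subspace_0[OF W] by (intro bexI[of _ v]) (simp_all add: bracket_simps)
  next
    case False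
    let ?P = "\<lambda>K. lie_subalgebra B K \<and> K \<subset> J"
    have P0: "?P {0}"
      using False vec.subspace_0[OF Jsub] by (auto simp: lie_subalgebra_def bracket_simps)
    have "\<forall>K. ?P K \<longrightarrow> vec.dim K < Suc (vec.dim J)"
      by (simp add: less_Suc_eq_le vec.dim_subset psubset_imp_subset)
    from ex_has_greatest_nat[of ?P "{0}" vec.dim, OF P0 this]
    obtain K where "?P K \<and> (\<forall>L. ?P L \<longrightarrow> vec.dim L \<le> vec.dim K)" ..
    then have K: "?P K" and maxK: "\<And>L. ?P L \<Longrightarrow> vec.dim L \<le> vec.dim K"
      by simp_all
    have Ksub: "vec.subspace K" and Kcl: "\<And>u v. u \<in> K \<Longrightarrow> v \<in> K \<Longrightarrow> B u v \<in> K"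
      using K unfolding lie_subalgebra_def by blast+
    have Kalg: "lie_subalgebra B K" and KltJ: "K \<subset> J" and KJ: "K \<subseteq> J" using K by auto
    have nilK: "\<And>u. u \<in> K \<Longrightarrow> nilpotent_elt B u" using KJ nil by blast
    have dimK: "vec.dim K < vec.dim J"
      using K by (intro vec.dim_psubset)
        (simp add: vec.span_eq_iff[THEN iffD2, OF Ksub] vec.span_eq_iff[THEN iffD2, OF Jsub])
    \<comment> \<open>First use of the induction hypothesis: \<open>K\<close> acts on
      \<open>J\<close> modulo \<open>K\<close>, which yields \<open>v\<close> normalizing
      \<open>K\<close>.\<close>
    have "\<exists>v\<in>J - K. \<forall>u\<in>K. B u v \<in> K"
    proof (rule less.hyps[OF dimK Kalg nilK Ksub Jsub KltJ Kcl])
      show "B u v \<in> J" if "u \<in> K" "v \<in> J" for u v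
        using that KJ J unfolding lie_subalgebra_def by blast
    qed
    then obtain v where v: "v \<in> J" "v \<notin> K" "\<And>u. u \<in> K \<Longrightarrow> B u v \<in> K" by blast
    define L where "L = vec.span (insert v K)"
    have L_iff: "x \<in> L \<longleftrightarrow> (\<exists>k. x - k *s v \<in> K)" for x
      by (simp only: L_def vec.span_breakdown_eq vec.span_eq_iff[THEN iffD2, OF Ksub])
    \<comment> \<open>Otherwise \<open>L\<close> would be a proper subalgebra of dimension one more
      than \<open>K\<close>.\<close>
    have "L = J"
    proof (rule ccontr)
      assume "L \<noteq> J"
      have "L \<subseteq> J" unfolding L_def using v(1) KJ Jsub by (intro vec.span_minimal) auto
      moreover have "lie_subalgebra B L"
        unfolding lie_subalgebra_def
      proof (intro conjI ballI)
        show "vec.subspace L" unfolding L_def by (rule vec.subspace_span)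
        fix x y assume "x \<in> L" "y \<in> L"
        then obtain p q where p: "x - p *s v \<in> K" and q: "y - q *s v \<in> K"
          using L_iff by blast
        define x' y' where "x' = x - p *s v" and "y' = y - q *s v"
        have xy: "x = x' + p *s v" "y = y' + q *s v" by (simp_all add: x'_def y'_def)
        have K': "x' \<in> K" "y' \<in> K" using p q by (simp_all add: x'_def y'_def)
        have "B x y = B x' y' + q *s B x' v - p *s B y' v"
          unfolding xy using antisym[of v y'] by (simp add: bracket_simps bracket_self)
        moreover have "\<dots> \<in> K"
          by (intro vec.subspace_diff[OF Ksub] vec.subspace_add[OF Ksub] vec.subspace_scale[OF Ksub]
              Kcl[OF K'] v(3)[OF K'(1)] v(3)[OF K'(2)])
        ultimately have "B x y \<in> K" by simp
        then show "B x y \<in> L" unfolding L_def by (blast intro: vec.span_base)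
      qed
      ultimately have "vec.dim L \<le> vec.dim K" using maxK \<open>L \<noteq> J\<close> by blast
      moreover have "vec.dim L = vec.dim K + 1"
        unfolding L_def vec.dim_span vec.dim_insert
        using v(2) by (simp add: vec.span_eq_iff[THEN iffD2, OF Ksub])
      ultimately show False by simp
    qed
    \<comment> \<open>Second use of the induction hypothesis: \<open>K\<close> acts on
      \<open>V\<close> modulo \<open>W\<close>.\<close>
    have "\<exists>w\<in>V - W. \<forall>u\<in>K. B u w \<in> W"
      by (rule less.hyps[OF dimK Kalg nilK W V WV stW[OF subsetD[OF KJ]] stV[OF subsetD[OF KJ]]])
    then obtain w0 where w0: "w0 \<in> V" "w0 \<notin> W" "\<And>u. u \<in> K \<Longrightarrow> B u w0 \<in> W" by blast
    \<comment> \<open>Since \<open>v\<close> normalizes \<open>K\<close>, the vectors killed by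
      \<open>K\<close> modulo \<open>W\<close> are stable under \<open>B v\<close>.\<close>
    have pow: "(B v ^^ k) w0 \<in> V \<and> (\<forall>u\<in>K. B u ((B v ^^ k) w0) \<in> W)" for k
    proof (induction k)
      case (Suc k)
      let ?w = "(B v ^^ k) w0"
      have "B u (B v ?w) \<in> W" if "u \<in> K" for u
        unfolding jacobi[of u v]
      proof (rule vec.subspace_add[OF W])
        show "B (B u v) ?w \<in> W" using Suc v(3)[OF that] by simp
        show "B v (B u ?w) \<in> W" using Suc that by (intro stW[OF v(1)]) simp
      qed
      then show ?case using Suc stV[OF v(1)] by simp
    qed (use w0 in simp)
    obtain n where "(B v ^^ n) w0 = 0"
      using nil[OF v(1)] unfolding nilpotent_elt_def by blast
    then have ex: "\<exists>m. (B v ^^ m) w0 \<in> W"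
      using vec.subspace_0[OF W] by (intro exI[of _ n]) simp
    \<comment> \<open>The last iterate outside \<open>W\<close>, with exponent \<open>k\<close> one
      below \<open>m\<close>, is killed modulo \<open>W\<close> by \<open>v\<close> and by
      \<open>K\<close>, hence by \<open>J\<close>.\<close>
    define m where "m = (LEAST m. (B v ^^ m) w0 \<in> W)"
    have m: "(B v ^^ m) w0 \<in> W" unfolding m_def using ex by (rule LeastI_ex)
    then obtain k where k: "m = Suc k" using w0(2) by (cases m) auto
    let ?w = "(B v ^^ k) w0"
    have "?w \<notin> W"
      using not_less_Least[of k "\<lambda>m. (B v ^^ m) w0 \<in> W"] k unfolding m_def[symmetric] by simp
    moreover have "B u ?w \<in> W" if "u \<in> J" for u
    proof -
      have "u \<in> L" using that \<open>L = J\<close> by simp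
      then obtain c where c: "u - c *s v \<in> K" unfolding L_iff ..
      have "B (u - c *s v) ?w + c *s B v ?w \<in> W"
      proof (rule vec.subspace_add[OF W])
        show "B (u - c *s v) ?w \<in> W" using pow[of k] c by blast
        show "c *s B v ?w \<in> W" using m unfolding k by (intro vec.subspace_scale[OF W]) simp
      qed
      then show ?thesis by (simp add: bracket_simps)
    qed
    ultimately show ?thesis using pow[of k] by blast
  qed
qed

lemma subspace_ad_flag: "vec.subspace (ad_flag B J j)"
proof (induction j)
  case (Suc j)
  then show ?case
    by (auto simp: vec.subspace_def bracket_simps)
qed (simp add: vec.subspace_def)

lemma ad_flag_mono: "ad_flag B J j \<subseteq> ad_flag B J (Suc j)"
proof (induction j)
  case 0
  then show ?case by (simp add: bracket_simps)
next
  case (Suc j)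
  then show ?case by auto
qed

text \<open>By Engel's theorem every proper step is strictly enlarged by the next, so a flag that
  never filled the space would have unbounded dimensions.\<close>

lemma ad_flag_exhausts:
  assumes "lie_subalgebra B J" "\<And>u. u \<in> J \<Longrightarrow> nilpotent_elt B u"
  shows "\<exists>m. ad_flag B J m = UNIV"
proof (rule ccontr)
  assume ne: "\<nexists>m. ad_flag B J m = UNIV"
  have "j \<le> vec.dim (ad_flag B J j)" for j
  proof (induction j)
    case (Suc j)
    have "\<exists>v\<in>UNIV - ad_flag B J j. \<forall>u\<in>J. B u v \<in> ad_flag B J j"
    proof (rule engel[OF assms subspace_ad_flag vec.subspace_UNIV])
      show "ad_flag B J j \<subset> UNIV" using ne by blast
      show "B u v \<in> ad_flag B J j" if "u \<in> J" "v \<in> ad_flag B J j" for u v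
        using subsetD[OF ad_flag_mono that(2)] that(1) by simp
    qed auto
    then obtain v where "v \<notin> ad_flag B J j" "v \<in> ad_flag B J (Suc j)" by auto
    then have "ad_flag B J j \<subset> ad_flag B J (Suc j)" using ad_flag_mono by blast
    then have "vec.dim (ad_flag B J j) < vec.dim (ad_flag B J (Suc j))"
      by (intro vec.dim_psubset) (simp only: vec.span_eq_iff[THEN iffD2, OF subspace_ad_flag])
    then show ?case using Suc by simp
  qed simp
  from this[of "Suc (vec.dim (UNIV :: (complex ^ 'n) set))"] show False
    using vec.dim_subset[OF subset_UNIV, of "ad_flag B J (Suc (vec.dim (UNIV :: (complex ^ 'n) set)))"]
    by linarith
qed

section \<open>The unipotent radical described by the Killing form\<close>

lemma ideal_subalgebra:
  "lie_ideal_in B J c \<Longrightarrow> lie_subalgebra B J"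
  unfolding lie_ideal_in_def lie_subalgebra_def by blast

text \<open>Elements of \<open>c\<close> preserve the flag of \<open>J\<close> and elements of
  \<open>J\<close> lower it, so \<open>B u (B a w)\<close> lowers it as well and has trace
  zero.\<close>

lemma nilpotent_ideal_subset_orth:
  assumes J: "lie_ideal_in B J c" and nil: "\<And>u. u \<in> J \<Longrightarrow> nilpotent_elt B u"
  shows "J \<subseteq> orth c"
proof -
  obtain m where m: "ad_flag B J m = UNIV"
    using ad_flag_exhausts[OF ideal_subalgebra[OF J] nil] by blast
  have stable: "v \<in> ad_flag B J j \<Longrightarrow> a \<in> c \<Longrightarrow> B a v \<in> ad_flag B J j" for a v j
  proof (induction j arbitrary: v)
    case (Suc j)
    have "B u (B a v) \<in> ad_flag B J j" if "u \<in> J" for u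
    proof -
      have "B u a \<in> J"
        using J that Suc.prems(2) antisym[of u a] vec.subspace_neg[of J "B a u"]
        unfolding lie_ideal_in_def by auto
      then show ?thesis
        unfolding jacobi[of u a] using Suc.prems that
        by (intro vec.subspace_add[OF subspace_ad_flag] Suc.IH) simp_all
    qed
    then show ?case by simp
  qed (simp add: bracket_simps)
  have "kf u a = 0" if "u \<in> J" "a \<in> c" for u a
    unfolding kf_def
  proof (rule tr_eq_0_if_lowers_flag[where W = "ad_flag B J" and m = m])
    show "clinear (\<lambda>w. B u (B a w))" by (rule clinear_compose[OF ad ad])
    show "B u (B a v) \<in> ad_flag B J j" if "v \<in> ad_flag B J (Suc j)" for j v
      using stable[OF that \<open>a \<in> c\<close>] \<open>u \<in> J\<close> by simp
  qed (use m subspace_ad_flag ad_flag_mono in auto)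
  then show ?thesis unfolding orth_def by blast
qed

text \<open>By invariance the radical of the restricted form is an ideal of \<open>c\<close>, and it
  contains every ideal of nilpotent elements. Once its own elements are nilpotent, it is the largest
  such ideal.\<close>

lemma rad_u_eq:
  assumes c: "lie_subalgebra B c" and nil: "\<And>u. u \<in> c \<inter> orth c \<Longrightarrow> nilpotent_elt B u"
  shows "rad_u B c = c \<inter> orth c"
proof -
  let ?N = "c \<inter> orth c"
  let ?nil_ideal = "\<lambda>J. lie_ideal_in B J c \<and> (\<forall>u\<in>J. nilpotent_elt B u)"
  have csub: "vec.subspace c" and cl: "\<And>u v. u \<in> c \<Longrightarrow> v \<in> c \<Longrightarrow> B u v \<in> c"
    using c unfolding lie_subalgebra_def by auto
  have "lie_ideal_in B ?N c"
    unfolding lie_ideal_in_def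
    using vec.subspace_inter[OF csub subspace_orth] cl orth_bracket[OF c] by simp
  then have N: "?nil_ideal ?N" using nil by simp
  have max: "J \<subseteq> ?N" if "?nil_ideal J" for J
  proof -
    have "J \<subseteq> orth c" using that nilpotent_ideal_subset_orth[of J c] by simp
    moreover have "J \<subseteq> c" using that unfolding lie_ideal_in_def by simp
    ultimately show ?thesis by simp
  qed
  show ?thesis
    unfolding rad_u_def
  proof (rule the_equality)
    show "lie_ideal_in B ?N c \<and> (\<forall>u\<in>?N. nilpotent_elt B u) \<and> (\<forall>J. ?nil_ideal J \<longrightarrow> J \<subseteq> ?N)"
      using N max by simp
    fix I assume I: "lie_ideal_in B I c \<and> (\<forall>u\<in>I. nilpotent_elt B u) \<and> (\<forall>J. ?nil_ideal J \<longrightarrow> J \<subseteq> I)"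
    show "I = ?N"
    proof (rule subset_antisym)
      show "I \<subseteq> ?N" using I by (intro max) simp
      show "?N \<subseteq> I" using I N by simp
    qed
  qed
qed

subsection \<open>Derivations and Cartan's criterion\<close>

text \<open>By the Leibniz rule, \<open>shift (B y) (l + m)\<close> turns \<open>B a b\<close> into
  two brackets, each with one exponent lowered; hence induction on \<open>j + k\<close>. An exponent
  zero means that the vector itself is zero.\<close>

lemma bracket_gen_eigenspace:
  assumes "a \<in> gen_eigenspace (B y) l" "b \<in> gen_eigenspace (B y) m"
  shows "B a b \<in> gen_eigenspace (B y) (l + m)"
proof -
  obtain j k where "(shift (B y) l ^^ j) a = 0" "(shift (B y) m ^^ k) b = 0"
    using assms unfolding gen_eigenspace_def by blast
  then show ?thesis
  proof (induction "j + k" arbitrary: j k a b)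
    case 0
    then show ?case
      using vec.subspace_0[OF subspace_gen_eigenspace[OF ad]] by (simp add: bracket_simps)
  next
    case (Suc n)
    note IH = Suc.hyps(1) and n = Suc.hyps(2) and a0 = Suc.prems(1) and b0 = Suc.prems(2)
    let ?G = "gen_eigenspace (B y) (l + m)"
    have 0: "0 \<in> ?G" by (rule vec.subspace_0[OF subspace_gen_eigenspace[OF ad]])
    have 1: "B (shift (B y) l a) b \<in> ?G"
    proof (cases j)
      case 0
      then show ?thesis
        using a0 \<open>0 \<in> ?G\<close> by (simp add: shift_def bracket_simps)
    next
      case (Suc i)
      show ?thesis
      proof (rule IH[of i k])
        show "n = i + k" using n Suc by simp
        show "(shift (B y) l ^^ i) (shift (B y) l a) = 0" using a0 Suc by (simp add: funpow_swap1)
      qed (rule b0)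
    qed
    have 2: "B a (shift (B y) m b) \<in> ?G"
    proof (cases k)
      case 0
      then show ?thesis
        using b0 \<open>0 \<in> ?G\<close> by (simp add: shift_def bracket_simps)
    next
      case (Suc i)
      show ?thesis
      proof (rule IH[of j i])
        show "n = j + i" using n Suc by simp
        show "(shift (B y) m ^^ i) (shift (B y) m b) = 0" using b0 Suc by (simp add: funpow_swap1)
      qed (rule a0)
    qed
    have "shift (B y) (l + m) (B a b) = B (shift (B y) l a) b + B a (shift (B y) m b)"
      by (simp add: shift_def bracket_simps jacobi[of y a b])
    then have "shift (B y) (l + m) (B a b) \<in> ?G"
      using vec.subspace_add[OF subspace_gen_eigenspace[OF ad] 1 2] by simp
    then show ?case by (rule in_gen_eigenspace_if_shift_in)
  qed
qed

definition derivation :: "(complex ^ 'n \<Rightarrow> complex ^ 'n) \<Rightarrow> bool" where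
  "derivation D \<longleftrightarrow> clinear D \<and> (\<forall>a b. D (B a b) = B (D a) b + B a (D b))"

text \<open>Brackets add eigenvalue labels and \<open>\<phi>\<close> is additive, so the product
  rule holds for generalized eigenvectors; it is then extended linearly in one argument at a
  time.\<close>

lemma derivation_spectral_map:
  assumes additive: "\<And>l m. \<phi> (l + m) = \<phi> l + \<phi> m"
  shows "derivation (spectral_map \<phi> (B y))"
proof -
  let ?S = "spectral_map \<phi> (B y)"
  note S = clinear_spectral_map[OF ad, of \<phi> y]
  have both: "?S (B a b) = B (?S a) b + B a (?S b)"
    if "a \<in> gen_eigenspace (B y) l" "b \<in> gen_eigenspace (B y) m" for a b l m
    by (simp only: spectral_map_eq[OF ad that(1)] spectral_map_eq[OF ad that(2)]
        spectral_map_eq[OF ad bracket_gen_eigenspace[OF that]] bracket_simps additive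
        vec.scale_left_distrib)
  have half: "?S (B a b) = B (?S a) b + B a (?S b)" if "a \<in> gen_eigenspace (B y) l" for a b l
    by (rule clinear_eq_if_eq_on_gen_eigenspaces[OF ad[of y] clinear_compose[OF S ad]
          clinear_plus[OF ad clinear_compose[OF ad S]]])
      (rule both[OF that])
  have "?S (B a b) = B (?S a) b + B a (?S b)" for a b
    by (rule clinear_eq_if_eq_on_gen_eigenspaces[OF ad[of y] clinear_compose[OF S ad_left]
          clinear_plus[OF clinear_compose[OF ad_left S] ad_left]]) (rule half)
  then show ?thesis unfolding derivation_def using S by blast
qed

text \<open>Cyclicity rewrites the trace as that of the commutator of \<open>D\<close> with
  \<open>B a\<close>, followed after \<open>B b\<close>; this commutator is
  \<open>B (D a)\<close>.\<close>

lemma tr_derivation_bracket: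
  assumes "derivation D"
  shows "tr (\<lambda>w. D (B (B a b) w)) = kf (D a) b"
proof -
  have D: "clinear D" and der: "\<And>a b. D (B a b) = B (D a) b + B a (D b)"
    using assms unfolding derivation_def by auto
  have "tr (\<lambda>w. D (B (B a b) w)) = tr (\<lambda>w. D (B a (B b w))) - tr (\<lambda>w. D (B b (B a w)))"
    by (simp only: ad_bracket clinear_diff[OF D] tr_diff)
  also have "tr (\<lambda>w. D (B b (B a w))) = tr (\<lambda>w. B a (D (B b w)))"
    by (rule tr_comp_commute[OF clinear_compose[OF D ad] ad])
  also have "tr (\<lambda>w. D (B a (B b w))) - tr (\<lambda>w. B a (D (B b w))) = kf (D a) b"
    unfolding kf_def by (simp only: der[of a] tr_add) simp
  finally show ?thesis .
qed

lemma nilpotent_if_in_derived_orth_UNIV: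
  assumes "y \<in> derived B (orth UNIV)"
  shows "nilpotent_elt B y"
proof -
  let ?S = "spectral_map cnj (B y)"
  note S = clinear_spectral_map[OF ad, of cnj y]
  have der: "derivation ?S" by (rule derivation_spectral_map) simp
  \<comment> \<open>The map \<open>?S\<close> stays attached to the fixed \<open>y\<close> while
    \<open>y'\<close> varies; this keeps the trace linear in \<open>y'\<close>, as the induction
    over the span requires.\<close>
  have "tr (\<lambda>w. ?S (B y' w)) = 0" if "y' \<in> derived B (orth UNIV)" for y'
    using that unfolding derived_def
  proof (induction rule: vec.span_induct_alt)
    case base
    then show ?case by (simp add: bracket_simps clinear_0[OF S] tr_zero)
  next
    case (step c x z)
    then obtain a b where x: "x = B a b" and b: "b \<in> orth UNIV" by blast
    have "tr (\<lambda>w. ?S (B x w)) = 0"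
      unfolding x tr_derivation_bracket[OF der] using b kf_sym[of b] by (auto simp: orth_def)
    then show ?case
      using step by (simp only: bracket_simps clinear_add[OF S] clinear_scale[OF S] tr_add tr_scale) simp
  qed
  from this[OF assms] show ?thesis
    unfolding nilpotent_elt_def by (rule nilpotent_if_tr_conj_spectral_map_eq_0[OF ad])
qed

text \<open>The derived algebra \<open>?D\<close> of the radical consists of nilpotent elements, so
  its Engel flag fills the space, and each further derived algebra sinks one step in the
  flag.\<close>

lemma solvable_orth_UNIV: "solvable_set B (orth UNIV)"
proof -
  let ?R = "orth UNIV"
  let ?D = "derived B ?R"
  have U: "lie_subalgebra B UNIV" by (simp add: lie_subalgebra_def)
  have DR: "?D \<subseteq> ?R"
    unfolding derived_def using orth_bracket[OF U] subspace_orth by (intro vec.span_minimal) auto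
  have D: "lie_subalgebra B ?D"
    unfolding lie_subalgebra_def
  proof (intro conjI ballI)
    show "vec.subspace ?D" unfolding derived_def by (rule vec.subspace_span)
    fix u v assume "u \<in> ?D" "v \<in> ?D"
    then have "u \<in> ?R" "v \<in> ?R" using DR by auto
    then show "B u v \<in> ?D" unfolding derived_def by (intro vec.span_base) blast
  qed
  obtain m where m: "ad_flag B ?D m = UNIV"
    using ad_flag_exhausts[OF D nilpotent_if_in_derived_orth_UNIV] by blast
  \<comment> \<open>At \<open>k = m\<close> the flag step is \<open>{0}\<close>; carrying along that
    \<open>0\<close> is a member turns the inclusion into an equality.\<close>
  have "(derived B ^^ k) ?D \<subseteq> ?D \<inter> ad_flag B ?D (m - k) \<and> 0 \<in> (derived B ^^ k) ?D" if "k \<le> m" for k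
    using that
  proof (induction k)
    case 0
    then show ?case using m D vec.subspace_0 unfolding lie_subalgebra_def by auto
  next
    case (Suc k)
    let ?I = "(derived B ^^ k) ?D"
    have IH: "?I \<subseteq> ?D" "?I \<subseteq> ad_flag B ?D (Suc (m - Suc k))"
      using Suc by (auto simp: Suc_diff_Suc)
    have "derived B ?I \<subseteq> ?D \<inter> ad_flag B ?D (m - Suc k)"
      unfolding derived_def[of B ?I]
    proof (rule vec.span_minimal)
      show "vec.subspace (?D \<inter> ad_flag B ?D (m - Suc k))"
        using D subspace_ad_flag vec.subspace_inter unfolding lie_subalgebra_def by blast
      show "{B u v |u v. u \<in> ?I \<and> v \<in> ?I} \<subseteq> ?D \<inter> ad_flag B ?D (m - Suc k)"
        using IH D unfolding lie_subalgebra_def by (simp only: ad_flag.simps) blast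
    qed
    moreover have "0 \<in> derived B ?I" unfolding derived_def[of B ?I] by (rule vec.span_zero)
    ultimately show ?case by simp
  qed
  from this[of m] have "(derived B ^^ m) ?D = {0}" by auto
  then have "(derived B ^^ Suc m) ?R = {0}" by (simp add: funpow_swap1)
  then show ?thesis unfolding solvable_set_def by blast
qed

end

lemma functional_expand:
  fixes F :: "complex ^ 'n \<Rightarrow> complex"
  assumes "\<And>x y. F (x + y) = F x + F y" "\<And>c x. F (c *s x) = c * F x"
  shows "F z = (\<Sum>i\<in>UNIV. z $ i * F (axis i 1))"
proof -
  \<comment> \<open>The functional is repeated in every coordinate, so that the expansion for linear
    endomorphisms applies.\<close>
  have "clinear (\<lambda>z. \<chi> i::'n. F z)"
    by (simp add: clinear_iff vec_eq_iff assms)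
  from clinear_expand[OF this, of z] show ?thesis
    by (simp add: vec_eq_iff)
qed

section \<open>Semisimple algebras: nondegeneracy, inner derivations and conjugate parts\<close>

locale semisimple_bracket =
  fixes B :: "complex ^ 'n \<Rightarrow> complex ^ 'n \<Rightarrow> complex ^ 'n"
  assumes semisimple: "semisimple_lie B"
begin

sublocale lie_bracket B
  by unfold_locales (use semisimple in \<open>simp add: semisimple_lie_def\<close>)

text \<open>The radical of the Killing form is a solvable ideal.\<close>

lemma kf_nondegenerate:
  assumes "\<And>v. kf u v = 0"
  shows "u = 0"
proof -
  have U: "lie_subalgebra B UNIV" by (simp add: lie_subalgebra_def)
  have "lie_ideal_in B (orth UNIV) UNIV"
    unfolding lie_ideal_in_def using subspace_orth orth_bracket[OF U] by blast
  then have "orth UNIV = {0}"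
    using semisimple solvable_orth_UNIV unfolding semisimple_lie_def by blast
  then show ?thesis using assms unfolding orth_def by blast
qed

lemma center_trivial:
  assumes "\<And>v. B u v = 0"
  shows "u = 0"
  by (rule kf_nondegenerate) (simp add: kf_def assms tr_zero)

text \<open>Nondegeneracy represents the functional sending \<open>z\<close> to the trace of
  \<open>D\<close> after \<open>B z\<close> as \<open>kf d\<close>. For the derivation
  \<open>E\<close> equal to \<open>D\<close> minus \<open>B d\<close> the corresponding traces
  vanish; on brackets they equal \<open>kf (E a) b\<close>, so \<open>E\<close> is zero.\<close>

lemma derivation_inner:
  assumes "derivation D"
  shows "\<exists>d. \<forall>z. D z = B d z"
proof -
  have D: "clinear D" and der: "\<And>a b. D (B a b) = B (D a) b + B a (D b)"
    using assms unfolding derivation_def by auto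
  \<comment> \<open>\<open>\<Phi> d\<close> lists the values of the functional \<open>kf d\<close>
    on the standard basis, which makes \<open>\<Phi>\<close> an endomorphism: injective implies
    surjective.\<close>
  define \<Phi> where "\<Phi> d = (\<chi> i. kf d (axis i 1))" for d
  have lin: "clinear \<Phi>"
    by (simp add: clinear_iff \<Phi>_def vec_eq_iff kf_add_left kf_scale_left)
  have kf_expand: "kf d z = (\<Sum>i\<in>UNIV. z $ i * kf d (axis i 1))" for d z
    by (rule functional_expand) (simp_all add: kf_add_right kf_scale_right)
  have "inj \<Phi>"
  proof (rule injI)
    fix d e assume "\<Phi> d = \<Phi> e"
    then have "kf d (axis i 1) = kf e (axis i 1)" for i by (simp add: \<Phi>_def vec_eq_iff)
    then have "kf (d - e) z = 0" for z
      unfolding kf_diff_left kf_expand[of d z] kf_expand[of e z] by simp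
    then have "d - e = 0" by (rule kf_nondegenerate)
    then show "d = e" by simp
  qed
  then have "surj \<Phi>"
    using lin vec.linear_inj_imp_surj unfolding clinear_def by blast
  then obtain d where d: "\<Phi> d = (\<chi> i. tr (\<lambda>w. D (B (axis i 1) w)))" by (metis surjD)
  have dz: "kf d z = tr (\<lambda>w. D (B z w))" for z
  proof -
    have "tr (\<lambda>w. D (B z w)) = (\<Sum>i\<in>UNIV. z $ i * tr (\<lambda>w. D (B (axis i 1) w)))"
      by (rule functional_expand[of "\<lambda>z. tr (\<lambda>w. D (B z w))"])
        (simp_all only: bracket_simps clinear_add[OF D] clinear_scale[OF D] tr_add tr_scale)
    then show ?thesis
      using d by (simp add: kf_expand[of d z] \<Phi>_def vec_eq_iff)
  qed
  define E where "E z = D z - B d z" for z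
  have E: "derivation E"
    unfolding derivation_def
  proof (intro conjI allI)
    show "clinear E" unfolding E_def by (intro clinear_sub D ad)
    show "E (B a b) = B (E a) b + B a (E b)" for a b
      unfolding E_def by (simp add: der jacobi[of d a b] bracket_simps)
  qed
  have "kf (E a) b = 0" for a b
    unfolding tr_derivation_bracket[OF E, symmetric]
    by (simp only: E_def tr_diff dz[symmetric]) (simp add: kf_def)
  then have "E a = 0" for a by (rule kf_nondegenerate)
  then show ?thesis unfolding E_def by (intro exI[of _ d]) simp
qed

lemma conj_part_exists:
  "\<exists>s. \<forall>w. B s w = spectral_map cnj (B y) w"
proof -
  from derivation_inner[OF derivation_spectral_map[of cnj, OF complex_cnj_add]]
  obtain d where "\<forall>z. spectral_map cnj (B y) z = B d z" ..
  then show ?thesis by (intro exI[of _ d]) simp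
qed

lemma nilpotent_if_kf_conj_part_eq_0:
  assumes "\<And>w. B s w = spectral_map cnj (B y) w" "kf s y = 0"
  shows "nilpotent_elt B y"
  unfolding nilpotent_elt_def
  by (rule nilpotent_if_tr_conj_spectral_map_eq_0[OF ad])
    (use assms(2) in \<open>simp add: kf_def assms(1)\<close>)

text \<open>\<open>x\<close> lies in the generalized eigenspace for 0, where the spectral map is
  multiplication by \<open>cnj 0\<close>.\<close>

lemma conj_part_commutes:
  assumes s: "\<And>w. B s w = spectral_map cnj (B y) w" and "B y x = 0"
  shows "B s x = 0"
proof -
  have "(shift (B y) 0 ^^ 1) x = 0" using assms(2) by (simp add: shift_def)
  then have "x \<in> gen_eigenspace (B y) 0" unfolding gen_eigenspace_def by blast
  then show ?thesis unfolding s by (simp add: spectral_map_eq[OF ad, of x y 0])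
qed

lemma conj_part_semisimple:
  assumes s: "\<And>w. B s w = spectral_map cnj (B y) w"
  shows "semisimple_elt B s"
proof -
  have "(\<Union>l. gen_eigenspace (B y) l) \<subseteq> {v. \<exists>c. B s v = c *s v}"
    unfolding s using spectral_map_eq[OF ad] by blast
  from vec.span_mono[OF this] show ?thesis
    unfolding semisimple_elt_def span_gen_eigenspaces[OF ad] by (rule top.extremum_uniqueI)
qed

lemma semisimple_nilpotent_eq_0:
  assumes "semisimple_elt B y" "nilpotent_elt B y"
  shows "y = 0"
proof -
  obtain k where k: "\<And>v. (B y ^^ k) v = 0"
    using assms(2) unfolding nilpotent_elt_def by blast
  have eig0: "B y v = 0" if "B y v = c *s v" for c v
  proof -
    have "(B y ^^ j) v = c ^ j *s v" for j
      by (induction j) (simp_all add: bracket_simps that mult.commute)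
    from this[of k] k[of v] show ?thesis using that by auto
  qed
  have "{v. \<exists>c. B y v = c *s v} \<subseteq> {v. B y v = 0}" using eig0 by blast
  from vec.span_minimal[OF this subspace_kernel[OF ad]] have "B y v = 0" for v
    using assms(1) unfolding semisimple_elt_def by auto
  then show ?thesis by (rule center_trivial)
qed

section \<open>Centralizers and their unipotent radical\<close>

lemma subalgebra_centralizer: "lie_subalgebra B (centralizer B x)"
  unfolding lie_subalgebra_def centralizer_def
  by (simp add: subspace_kernel[OF ad] jacobi[of x] bracket_simps)

lemma nilpotent_in_centralizer_orth:
  assumes "u \<in> centralizer B x \<inter> orth (centralizer B x)"
  shows "nilpotent_elt B u"
proof -
  from conj_part_exists obtain s where "\<forall>w. B s w = spectral_map cnj (B u) w" ..
  then have s: "\<And>w. B s w = spectral_map cnj (B u) w" ..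
  have "B u x = 0" using assms antisym[of u x] unfolding centralizer_def by simp
  then have "B s x = 0" by (rule conj_part_commutes[OF s])
  then have "s \<in> centralizer B x" using antisym[of x s] unfolding centralizer_def by simp
  then have "kf s u = 0" using assms kf_sym[of s u] unfolding orth_def by simp
  then show ?thesis by (rule nilpotent_if_kf_conj_part_eq_0[OF s])
qed

lemma rad_u_centralizer:
  "rad_u B (centralizer B x) = centralizer B x \<inter> orth (centralizer B x)"
  by (rule rad_u_eq[OF subalgebra_centralizer nilpotent_in_centralizer_orth])

end

section \<open>Involutions\<close>

text \<open>A map of \<open>c\<close> modulo \<open>I\<close> onto \<open>d\<close> modulo
  \<open>J\<close> cannot raise the dimension. Quotients are avoided by a complement
  \<open>C\<close> of \<open>I\<close> in \<open>c\<close>, the kernel of a projection: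
  \<open>f\<close> maps \<open>C\<close> onto \<open>d\<close> up to \<open>J\<close>.\<close>

lemma dim_le_if_covers_quotient:
  fixes c d I J :: "(complex ^ 'n) set"
  assumes f: "clinear f" and c: "vec.subspace c" and I: "vec.subspace I" "I \<subseteq> c"
    and J: "vec.subspace J" and fI: "\<And>u. u \<in> I \<Longrightarrow> f u \<in> J"
    and onto: "\<And>w. w \<in> d \<Longrightarrow> \<exists>u\<in>c. w - f u \<in> J"
  shows "vec.dim d + vec.dim I \<le> vec.dim c + vec.dim J"
proof -
  from projection_exists[OF I(1)] obtain \<pi> where
    "clinear \<pi> \<and> (\<forall>v. \<pi> v \<in> I) \<and> (\<forall>v\<in>I. \<pi> v = v)" ..
  then have \<pi>: "clinear \<pi>" "\<And>v. \<pi> v \<in> I" "\<And>v. v \<in> I \<Longrightarrow> \<pi> v = v" by auto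
  define C where "C = c \<inter> {u. \<pi> u = 0}"
  have C: "vec.subspace C"
    unfolding C_def by (rule vec.subspace_inter[OF c subspace_kernel[OF \<pi>(1)]])
  have "C \<inter> I \<subseteq> {0}"
  proof
    fix v assume "v \<in> C \<inter> I"
    then show "v \<in> {0}" using \<pi>(3)[of v] unfolding C_def by simp
  qed
  then have "vec.dim (C \<inter> I) = 0" unfolding vec.dim_eq_0 .
  moreover have "{x + y |x y. x \<in> C \<and> y \<in> I} \<subseteq> c"
    using I(2) by (auto simp: C_def intro: vec.subspace_add[OF c])
  then have "vec.dim {x + y |x y. x \<in> C \<and> y \<in> I} \<le> vec.dim c" by (rule vec.dim_subset)
  ultimately have dimC: "vec.dim C + vec.dim I \<le> vec.dim c"
    using vec.dim_sums_Int[OF C I(1)] by linarith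
  have fC: "vec.subspace (f ` C)"
    by (rule vec.linear_subspace_image[OF f[unfolded clinear_def] C])
  have "d \<subseteq> {x + y |x y. x \<in> f ` C \<and> y \<in> J}"
  proof
    fix w assume "w \<in> d"
    then obtain u where u: "u \<in> c" "w - f u \<in> J" using onto by blast
    have "u - \<pi> u \<in> C"
      unfolding C_def using vec.subspace_diff[OF c u(1) subsetD[OF I(2) \<pi>(2)]]
      by (simp add: clinear_diff[OF \<pi>(1)] \<pi>(3)[OF \<pi>(2)])
    moreover have "(w - f u) + f (\<pi> u) \<in> J"
      by (rule vec.subspace_add[OF J u(2) fI[OF \<pi>(2)]])
    moreover have "w = f (u - \<pi> u) + ((w - f u) + f (\<pi> u))"
      by (simp add: clinear_diff[OF f])
    ultimately show "w \<in> {x + y |x y. x \<in> f ` C \<and> y \<in> J}" by blast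
  qed
  then have "vec.dim d \<le> vec.dim {x + y |x y. x \<in> f ` C \<and> y \<in> J}" by (rule vec.dim_subset)
  also have "\<dots> \<le> vec.dim (f ` C) + vec.dim J"
    using vec.dim_sums_Int[OF fC J] by linarith
  also have "vec.dim (f ` C) \<le> vec.dim C"
    by (rule vec.dim_image_le[OF f[unfolded clinear_def]])
  finally show ?thesis using dimC by linarith
qed

locale involutive_bracket = semisimple_bracket B
  for B :: "complex ^ 'n \<Rightarrow> complex ^ 'n \<Rightarrow> complex ^ 'n" +
  fixes \<theta> :: "complex ^ 'n \<Rightarrow> complex ^ 'n"
  assumes automorphism: "lie_automorphism B \<theta>" and involution: "\<theta> \<circ> \<theta> = id"
begin

lemma theta_linear: "clinear \<theta>"
  and theta_bracket: "\<theta> (B u v) = B (\<theta> u) (\<theta> v)"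
  using automorphism unfolding lie_automorphism_def by auto

lemma theta_theta: "\<theta> (\<theta> v) = v"
  using involution by (rule pointfree_idE)

abbreviation "\<kk> \<equiv> fixed_space \<theta>"
abbreviation "\<pp> \<equiv> anti_space \<theta>"

lemma subspace_fixed: "vec.subspace \<kk>"
  and subspace_anti: "vec.subspace \<pp>"
  unfolding fixed_space_def anti_space_def vec.subspace_def
  by (simp_all add: clinear_0[OF theta_linear] clinear_add[OF theta_linear]
      clinear_scale[OF theta_linear])

lemma ad_theta: "B (\<theta> u) w = \<theta> (B u (\<theta> w))"
  by (simp add: theta_bracket theta_theta)

text \<open>The operator defining the left side is conjugate by \<open>\<theta>\<close> to the one
  on the right, and the trace is cyclic.\<close>

lemma kf_theta: "kf (\<theta> u) (\<theta> v) = kf u v"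
proof -
  have "kf (\<theta> u) (\<theta> v) = tr (\<lambda>w. \<theta> (B u (B v (\<theta> w))))"
    unfolding kf_def by (simp only: ad_theta theta_theta)
  also have "\<dots> = tr (\<lambda>w. B u (B v (\<theta> (\<theta> w))))"
    by (rule tr_comp_commute[OF theta_linear
          clinear_compose[OF ad clinear_compose[OF ad theta_linear]]])
  finally show ?thesis by (simp only: theta_theta kf_def)
qed

lemma kf_fixed_anti:
  assumes "u \<in> \<kk>" "v \<in> \<pp>"
  shows "kf u v = 0"
proof -
  have "kf u v = kf u ((- 1) *s v)"
    using kf_theta[of u v] assms unfolding fixed_space_def anti_space_def by simp
  then show ?thesis unfolding kf_scale_right by simp
qed

lemma theta_decomposition:
  assumes W: "vec.subspace W" and stable: "\<And>v. v \<in> W \<Longrightarrow> \<theta> v \<in> W" and v: "v \<in> W"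
  obtains a b where "v = a + b" "a \<in> W \<inter> \<kk>" "b \<in> W \<inter> \<pp>"
proof
  let ?a = "(1/2) *s (v + \<theta> v)" and ?b = "(1/2) *s (v - \<theta> v)"
  have "?a + ?b = (1/2) *s (2 *s v)"
    by (simp only: vec.scale_right_distrib[symmetric]) (simp add: vec_eq_iff)
  then show "v = ?a + ?b" by simp
  show "?a \<in> W \<inter> \<kk>"
    using vec.subspace_scale[OF W vec.subspace_add[OF W v stable[OF v]]]
    unfolding fixed_space_def
    by (simp add: clinear_scale[OF theta_linear] clinear_add[OF theta_linear] theta_theta add.commute)
  have "\<theta> ?b = (1/2) *s (- (v - \<theta> v))"
    by (simp only: clinear_scale[OF theta_linear] clinear_diff[OF theta_linear] theta_theta minus_diff_eq)
  then show "?b \<in> W \<inter> \<pp>"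
    using vec.subspace_scale[OF W vec.subspace_diff[OF W v stable[OF v]]]
    unfolding anti_space_def by (simp only: vec.scale_minus_right) simp
qed

lemma dim_theta_decomposition:
  assumes W: "vec.subspace W" and stable: "\<And>v. v \<in> W \<Longrightarrow> \<theta> v \<in> W"
  shows "vec.dim W = vec.dim (W \<inter> \<kk>) + vec.dim (W \<inter> \<pp>)"
proof -
  note sub = vec.subspace_inter[OF W subspace_fixed] vec.subspace_inter[OF W subspace_anti]
  have "(W \<inter> \<kk>) \<inter> (W \<inter> \<pp>) \<subseteq> {0}"
  proof
    fix v assume "v \<in> (W \<inter> \<kk>) \<inter> (W \<inter> \<pp>)"
    then have "v = - v" unfolding fixed_space_def anti_space_def by auto
    then have "v $ i = 0" for i
      using arg_cong[of v "- v" "\<lambda>v. v $ i"] by simp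
    then show "v \<in> {0}" by (simp add: vec_eq_iff)
  qed
  then have "vec.dim ((W \<inter> \<kk>) \<inter> (W \<inter> \<pp>)) = 0" unfolding vec.dim_eq_0 .
  moreover have "{x + y |x y. x \<in> W \<inter> \<kk> \<and> y \<in> W \<inter> \<pp>} = W"
  proof (rule subset_antisym)
    show "{x + y |x y. x \<in> W \<inter> \<kk> \<and> y \<in> W \<inter> \<pp>} \<subseteq> W"
      using vec.subspace_add[OF W] by auto
    show "W \<subseteq> {x + y |x y. x \<in> W \<inter> \<kk> \<and> y \<in> W \<inter> \<pp>}"
    proof
      fix v assume v: "v \<in> W"
      obtain a b where "v = a + b" "a \<in> W \<inter> \<kk>" "b \<in> W \<inter> \<pp>"
        by (rule theta_decomposition[OF W stable v])
      then show "v \<in> {x + y |x y. x \<in> W \<inter> \<kk> \<and> y \<in> W \<inter> \<pp>}" by blast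
    qed
  qed
  ultimately show ?thesis using vec.dim_sums_Int[OF sub] by (simp only: add_0_right)
qed

text \<open>For \<open>y\<close> in \<open>\<pp>\<close>, \<open>\<theta>\<close> anticommutes with
  \<open>B y\<close>, so it carries \<open>shift (B y) l\<close> to minus
  \<open>shift (B y) (- l)\<close>.\<close>

lemma theta_gen_eigenspace:
  assumes y: "y \<in> \<pp>" and "v \<in> gen_eigenspace (B y) l"
  shows "\<theta> v \<in> gen_eigenspace (B y) (- l)"
proof -
  obtain k where "(shift (B y) l ^^ k) v = 0"
    using assms(2) unfolding gen_eigenspace_def by blast
  then show ?thesis
  proof (induction k arbitrary: v)
    case 0
    then show ?case
      using vec.subspace_0[OF subspace_gen_eigenspace[OF ad]] by (simp add: clinear_0[OF theta_linear])
  next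
    case (Suc k)
    have "\<theta> (shift (B y) l v) \<in> gen_eigenspace (B y) (- l)"
      by (rule Suc.IH) (use Suc.prems in \<open>simp add: funpow_swap1\<close>)
    then have "- \<theta> (shift (B y) l v) \<in> gen_eigenspace (B y) (- l)"
      by (rule vec.subspace_neg[OF subspace_gen_eigenspace[OF ad]])
    moreover have "- \<theta> (shift (B y) l v) = shift (B y) (- l) (\<theta> v)"
      using y by (simp add: shift_def anti_space_def clinear_diff[OF theta_linear]
          clinear_scale[OF theta_linear] theta_bracket bracket_simps)
    ultimately show ?case by (intro in_gen_eigenspace_if_shift_in[of "B y" "- l" "\<theta> v"]) simp
  qed
qed

text \<open>\<open>\<theta>\<close> exchanges the generalized eigenspaces for \<open>l\<close> and
  \<open>- l\<close>, and conjugation is odd; hence \<open>\<theta> s\<close> and \<open>- s\<close>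
  act alike, and they agree because the center is trivial.\<close>

lemma conj_part_anti:
  assumes s: "\<And>w. B s w = spectral_map cnj (B y) w" and y: "y \<in> \<pp>"
  shows "s \<in> \<pp>"
proof -
  have "B (\<theta> s) v = - B s v" for v
  proof (rule clinear_eq_if_eq_on_gen_eigenspaces[OF ad ad clinear_uminus[OF ad]])
    fix l v assume v: "v \<in> gen_eigenspace (B y) l"
    have "B (\<theta> s) v = \<theta> (cnj (- l) *s \<theta> v)"
      unfolding ad_theta s spectral_map_eq[OF ad theta_gen_eigenspace[OF y v]] ..
    also have "\<dots> = - (cnj l *s v)"
      by (simp add: clinear_scale[OF theta_linear] clinear_minus[OF theta_linear] theta_theta)
    finally show "B (\<theta> s) v = - B s v"
      unfolding s spectral_map_eq[OF ad v] .
  qed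
  then have "B (\<theta> s + s) v = 0" for v by (simp add: bracket_simps)
  then have "\<theta> s + s = 0" by (rule center_trivial)
  then show ?thesis unfolding anti_space_def by (simp add: eq_neg_iff_add_eq_0)
qed

lemma theta_centralizer:
  assumes "x \<in> \<pp>" "v \<in> centralizer B x"
  shows "\<theta> v \<in> centralizer B x"
proof -
  have "B x (\<theta> v) = - \<theta> (B x v)"
    using assms(1) unfolding anti_space_def by (simp add: theta_bracket bracket_simps)
  then show ?thesis
    using assms(2) unfolding centralizer_def by (simp add: clinear_0[OF theta_linear])
qed

lemma theta_orth:
  assumes stable: "\<And>v. v \<in> c \<Longrightarrow> \<theta> v \<in> c" and u: "u \<in> orth c"
  shows "\<theta> u \<in> orth c"
proof -
  have "kf (\<theta> u) v = 0" if "v \<in> c" for v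
    using kf_theta[of u "\<theta> v"] u stable[OF that] unfolding orth_def theta_theta by simp
  then show ?thesis unfolding orth_def by simp
qed

text \<open>An element of \<open>\<kk>\<close> is automatically orthogonal to the
  \<open>\<pp>\<close>-part of \<open>c\<close>, so only the \<open>\<kk>\<close>-part imposes a
  condition.\<close>

lemma orth_fixed_part:
  assumes c: "vec.subspace c" and stable: "\<And>v. v \<in> c \<Longrightarrow> \<theta> v \<in> c"
  shows "\<kk> \<inter> orth (c \<inter> \<kk>) = \<kk> \<inter> orth c"
proof (rule subset_antisym)
  show "\<kk> \<inter> orth c \<subseteq> \<kk> \<inter> orth (c \<inter> \<kk>)" unfolding orth_def by auto
  show "\<kk> \<inter> orth (c \<inter> \<kk>) \<subseteq> \<kk> \<inter> orth c"
  proof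
    fix u assume u: "u \<in> \<kk> \<inter> orth (c \<inter> \<kk>)"
    have "kf u v = 0" if v: "v \<in> c" for v
    proof -
      obtain a b where ab: "v = a + b" "a \<in> c \<inter> \<kk>" "b \<in> c \<inter> \<pp>"
        by (rule theta_decomposition[OF c stable v])
      have "kf u a = 0" using u ab(2) unfolding orth_def by auto
      moreover have "kf u b = 0" using u ab(3) by (intro kf_fixed_anti) auto
      ultimately show ?thesis unfolding ab(1) kf_add_right by simp
    qed
    then show "u \<in> \<kk> \<inter> orth c" using u unfolding orth_def by auto
  qed
qed

lemma rad_u_centralizer_fixed:
  assumes x: "x \<in> \<pp>"
  shows "rad_u B (centralizer B x \<inter> \<kk>) = rad_u B (centralizer B x) \<inter> \<kk>"
proof -
  let ?c = "centralizer B x"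
  have c: "vec.subspace ?c" using subalgebra_centralizer unfolding lie_subalgebra_def by blast
  have eq: "(?c \<inter> \<kk>) \<inter> orth (?c \<inter> \<kk>) = (?c \<inter> orth ?c) \<inter> \<kk>"
    using orth_fixed_part[OF c theta_centralizer[OF x]] by auto
  have "lie_subalgebra B (?c \<inter> \<kk>)"
    unfolding lie_subalgebra_def
  proof (intro conjI ballI)
    show "vec.subspace (?c \<inter> \<kk>)" by (rule vec.subspace_inter[OF c subspace_fixed])
    fix u v assume uv: "u \<in> ?c \<inter> \<kk>" "v \<in> ?c \<inter> \<kk>"
    then have "B u v \<in> ?c" using subalgebra_centralizer unfolding lie_subalgebra_def by auto
    moreover have "B u v \<in> \<kk>" using uv unfolding fixed_space_def by (simp add: theta_bracket)
    ultimately show "B u v \<in> ?c \<inter> \<kk>" by simp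
  qed
  then have "rad_u B (?c \<inter> \<kk>) = (?c \<inter> \<kk>) \<inter> orth (?c \<inter> \<kk>)"
    by (rule rad_u_eq) (unfold eq, use nilpotent_in_centralizer_orth in auto)
  then show ?thesis unfolding eq rad_u_centralizer .
qed

section \<open>The three conditions as one inclusion\<close>

lemma minus1_distinguished_iff:
  assumes x: "x \<in> \<pp>"
  shows "minus1_distinguished B \<theta> x \<longleftrightarrow> centralizer B x \<inter> \<pp> \<subseteq> rad_u B (centralizer B x)"
proof
  let ?c = "centralizer B x"
  have c: "vec.subspace ?c" using subalgebra_centralizer unfolding lie_subalgebra_def by blast
  show "?c \<inter> \<pp> \<subseteq> rad_u B ?c" if dist: "minus1_distinguished B \<theta> x"
  proof
    have nil: "nilpotent_elt B y" if y: "y \<in> ?c \<inter> \<pp>" for y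
    proof -
      from conj_part_exists obtain s where "\<forall>w. B s w = spectral_map cnj (B y) w" ..
      then have s: "\<And>w. B s w = spectral_map cnj (B y) w" ..
      have "B y x = 0" using y antisym[of y x] unfolding centralizer_def by simp
      then have "B s x = 0" by (rule conj_part_commutes[OF s])
      then have "s \<in> ?c" using antisym[of x s] unfolding centralizer_def by simp
      then have "s = 0"
        using dist conj_part_semisimple[OF s] conj_part_anti[OF s] y
        unfolding minus1_distinguished_def by auto
      then show ?thesis by (intro nilpotent_if_kf_conj_part_eq_0[OF s]) (simp add: kf_zero_left)
    qed
    fix y assume y: "y \<in> ?c \<inter> \<pp>"
    \<comment> \<open>Polarization: \<open>y\<close>, \<open>z\<close> and \<open>y + z\<close> are
      all nilpotent, so each pairs to zero with itself.\<close>
    have anti: "kf y z = 0" if z: "z \<in> ?c \<inter> \<pp>" for z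
    proof -
      have "y + z \<in> ?c \<inter> \<pp>"
        by (rule vec.subspace_add[OF vec.subspace_inter[OF c subspace_anti] y z])
      then have "kf (y + z) (y + z) = 0" by (intro kf_nilpotent_self nil)
      then show ?thesis
        using kf_nilpotent_self[OF nil[OF y]] kf_nilpotent_self[OF nil[OF z]] kf_sym[of z y]
        by (simp add: kf_add_left kf_add_right)
    qed
    have "kf y v = 0" if v: "v \<in> ?c" for v
    proof -
      obtain a b where ab: "v = a + b" "a \<in> ?c \<inter> \<kk>" "b \<in> ?c \<inter> \<pp>"
        by (rule theta_decomposition[OF c theta_centralizer[OF x] v])
      have "kf y a = 0" unfolding kf_sym[of y a] using y ab(2) by (intro kf_fixed_anti) auto
      then show ?thesis unfolding ab(1) kf_add_right using anti[OF ab(3)] by simp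
    qed
    then show "y \<in> rad_u B ?c" using y unfolding rad_u_centralizer orth_def by simp
  qed
  show "minus1_distinguished B \<theta> x" if sub: "?c \<inter> \<pp> \<subseteq> rad_u B ?c"
    unfolding minus1_distinguished_def
  proof (intro ballI impI)
    fix y assume y: "y \<in> ?c \<inter> \<pp>" and ss: "semisimple_elt B y"
    have "nilpotent_elt B y"
      using y sub unfolding rad_u_centralizer by (intro nilpotent_in_centralizer_orth) (rule subsetD)
    then show "y = 0" by (rule semisimple_nilpotent_eq_0[OF ss])
  qed
qed

text \<open>Splitting the centralizer and its radical by \<open>\<theta>\<close> shows that the two
  Levi dimensions differ by the dimension of the \<open>\<pp>\<close>-part of the centralizer minus
  that of the \<open>\<pp>\<close>-part of the radical.\<close>

lemma levi_dim_eq_iff: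
  assumes x: "x \<in> \<pp>"
  shows "levi_dim B (centralizer B x \<inter> \<kk>) = levi_dim B (centralizer B x)
    \<longleftrightarrow> centralizer B x \<inter> \<pp> \<subseteq> rad_u B (centralizer B x)"
    and "levi_dim B (centralizer B x \<inter> \<kk>) \<le> levi_dim B (centralizer B x)"
proof -
  let ?c = "centralizer B x" let ?N = "rad_u B ?c"
  have c: "vec.subspace ?c" using subalgebra_centralizer unfolding lie_subalgebra_def by blast
  have N: "vec.subspace ?N"
    unfolding rad_u_centralizer by (rule vec.subspace_inter[OF c subspace_orth])
  have Nc: "?N \<subseteq> ?c" unfolding rad_u_centralizer by simp
  have dc: "vec.dim ?c = vec.dim (?c \<inter> \<kk>) + vec.dim (?c \<inter> \<pp>)"
    by (rule dim_theta_decomposition[OF c theta_centralizer[OF x]])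
  have dN: "vec.dim ?N = vec.dim (?N \<inter> \<kk>) + vec.dim (?N \<inter> \<pp>)"
  proof (rule dim_theta_decomposition[OF N])
    show "\<theta> v \<in> ?N" if "v \<in> ?N" for v
      using that theta_centralizer[OF x] theta_orth[of ?c v, OF theta_centralizer[OF x]]
      unfolding rad_u_centralizer by simp
  qed
  \<comment> \<open>These bounds keep the truncated subtractions in \<open>levi_dim\<close>
    exact.\<close>
  have le: "vec.dim (?N \<inter> \<kk>) \<le> vec.dim (?c \<inter> \<kk>)" "vec.dim (?N \<inter> \<pp>) \<le> vec.dim (?c \<inter> \<pp>)"
    by (rule vec.dim_subset, use Nc in auto)+
  have iff: "vec.dim (?c \<inter> \<pp>) \<le> vec.dim (?N \<inter> \<pp>) \<longleftrightarrow> ?c \<inter> \<pp> \<subseteq> ?N"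
  proof
    assume "vec.dim (?c \<inter> \<pp>) \<le> vec.dim (?N \<inter> \<pp>)"
    then have "?N \<inter> \<pp> = ?c \<inter> \<pp>"
      using Nc by (intro vec.subspace_dim_equal vec.subspace_inter c N subspace_anti) auto
    then show "?c \<inter> \<pp> \<subseteq> ?N" by auto
  next
    assume "?c \<inter> \<pp> \<subseteq> ?N"
    then show "vec.dim (?c \<inter> \<pp>) \<le> vec.dim (?N \<inter> \<pp>)" by (intro vec.dim_subset) auto
  qed
  show "levi_dim B (?c \<inter> \<kk>) = levi_dim B ?c \<longleftrightarrow> ?c \<inter> \<pp> \<subseteq> ?N"
    unfolding levi_dim_def rad_u_centralizer_fixed[OF x] iff[symmetric] using dc dN le by linarith
  show "levi_dim B (?c \<inter> \<kk>) \<le> levi_dim B ?c"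
    unfolding levi_dim_def rad_u_centralizer_fixed[OF x] using dc dN le by linarith
qed

text \<open>An isomorphism covers the second quotient and so supplies the missing inequality of
  dimensions. Conversely, equal dimensions put the \<open>\<pp>\<close>-part into the radical, and
  then the inclusion of the \<open>\<kk>\<close>-part, given by \<open>id\<close>, induces the
  isomorphism.\<close>

lemma levi_iso_iff:
  assumes x: "x \<in> \<pp>"
  shows "levi_iso B (centralizer B x \<inter> \<kk>) (centralizer B x)
    \<longleftrightarrow> levi_dim B (centralizer B x \<inter> \<kk>) = levi_dim B (centralizer B x)"
proof
  let ?c = "centralizer B x" let ?N = "rad_u B ?c"
  have c: "vec.subspace ?c" using subalgebra_centralizer unfolding lie_subalgebra_def by blast
  have N: "vec.subspace ?N"
    unfolding rad_u_centralizer by (rule vec.subspace_inter[OF c subspace_orth])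
  have Nc: "?N \<subseteq> ?c" unfolding rad_u_centralizer by simp
  show "levi_dim B (?c \<inter> \<kk>) = levi_dim B ?c" if iso: "levi_iso B (?c \<inter> \<kk>) ?c"
  proof -
    obtain f where f: "clinear f" "\<forall>w\<in>?c. \<exists>u\<in>?c \<inter> \<kk>. w - f u \<in> ?N"
        "\<forall>u\<in>?c \<inter> \<kk>. f u \<in> ?N \<longleftrightarrow> u \<in> ?N \<inter> \<kk>"
      using iso unfolding levi_iso_def quotients_iso_def rad_u_centralizer_fixed[OF x] by blast
    have "vec.dim ?c + vec.dim (?N \<inter> \<kk>) \<le> vec.dim (?c \<inter> \<kk>) + vec.dim ?N"
    proof (rule dim_le_if_covers_quotient[OF f(1)])
      show "f u \<in> ?N" if "u \<in> ?N \<inter> \<kk>" for u using f(3) that Nc by auto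
    qed (use f(2) c N Nc in \<open>auto intro: vec.subspace_inter subspace_fixed\<close>)
    then have "levi_dim B ?c \<le> levi_dim B (?c \<inter> \<kk>)"
      unfolding levi_dim_def rad_u_centralizer_fixed[OF x] by linarith
    then show ?thesis using levi_dim_eq_iff(2)[OF x] by linarith
  qed
  show "levi_iso B (?c \<inter> \<kk>) ?c" if "levi_dim B (?c \<inter> \<kk>) = levi_dim B ?c"
  proof -
    have sub: "?c \<inter> \<pp> \<subseteq> ?N" using that levi_dim_eq_iff(1)[OF x] by simp
    have "\<exists>u\<in>?c \<inter> \<kk>. w - id u \<in> ?N" if w: "w \<in> ?c" for w
    proof -
      obtain a b where ab: "w = a + b" "a \<in> ?c \<inter> \<kk>" "b \<in> ?c \<inter> \<pp>"
        by (rule theta_decomposition[OF c theta_centralizer[OF x] w])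
      then show ?thesis using subsetD[OF sub ab(3)] by (intro bexI[of _ a]) simp_all
    qed
    then show ?thesis
      unfolding levi_iso_def quotients_iso_def rad_u_centralizer_fixed[OF x]
      using vec.subspace_0[OF N] by (intro exI[of _ id]) (simp add: clinear_id)
  qed
qed

end

theorem theorem4:
  fixes B :: "complex ^ 'n \<Rightarrow> complex ^ 'n \<Rightarrow> complex ^ 'n"
    and \<theta> :: "complex ^ 'n \<Rightarrow> complex ^ 'n"
    and x :: "complex ^ 'n"
  assumes "semisimple_lie B"
    and "lie_automorphism B \<theta>" and "\<theta> \<circ> \<theta> = id" and "\<theta> \<noteq> id"
    and "nilpotent_elt B x" and "x \<in> anti_space \<theta>"
  shows "(minus1_distinguished B \<theta> x
            \<longleftrightarrow> levi_dim B (centralizer B x \<inter> fixed_space \<theta>) = levi_dim B (centralizer B x))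
       \<and> (levi_dim B (centralizer B x \<inter> fixed_space \<theta>) = levi_dim B (centralizer B x)
            \<longleftrightarrow> levi_iso B (centralizer B x \<inter> fixed_space \<theta>) (centralizer B x))"
proof -
  interpret involutive_bracket B \<theta>
    by unfold_locales (use assms(1-3) in auto)
  show ?thesis
    using minus1_distinguished_iff[OF assms(6)] levi_dim_eq_iff(1)[OF assms(6)]
      levi_iso_iff[OF assms(6)] by simp
qed

end
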